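(* Let $n,d,r$ be positive integers. There exists an open and dense semi-algebraic set $\mathcal{U}_4$ in $\mathbb{R}^{r\times n(d)}$ such that for any $u\in\mathcal{U}_4$: (a) for any distinct points $x^0,\tilde{x}^0\in\mathbb{R}^n$ and any (not necessarily distinct) $f,\tilde{f}\in\mathcal{C}(F(x,u))$ such that $x^0$ is a critical point of $f$ and $\tilde{x}^0$ is a critical point of $\tilde{f}$, one has $f(x^0)\neq\tilde{f}(\tilde{x}^0)$; and (b) for any $f\in\mathcal{C}(F(x,u))$, the optimization problem $\min_{x\in\mathbb{R}^n} f(x)$ has at most one optimal solution.
   Context: Let $n(d):=\#\{\alpha\in\mathbb{N}^n : |\alpha|\le d\}$, where $|\alpha|=\alpha_1+\cdots+\alpha_n$. For $u=(u^{(1)},\ldots,u^{(r)})\in\mathbb{R}^{r\times n(d)}$ with $u^{(i)}=(u^{(i)}_\alpha)_{|\alpha|\le d}\in\mathbb{R}^{n(d)}$, put $f_i(x,u^{(i)})=\sum_{|\alpha|\le d}u^{(i)}_\alpha x^\alpha$, a polynomial in $x\in\mathbb{R}^n$ of degree at most $d$, and $F(x,u)=(f_1(x,u^{(1)}),\ldots,f_r(x,u^{(r)}))$. $\mathcal{C}(F(x,u))$ is the set of all continuous selections of these polynomials, i.e. all continuous functions $f\colon\mathbb{R}^n\to\mathbb{R}$ with $f(x)\in\{f_1(x,u^{(1)}),\ldots,f_r(x,u^{(r)})\}$ for every $x\in\mathbb{R}^n$; such functions are locally Lipschitz. For a locally Lipschitz $f$, $f^0(\bar x;v)=\limsup_{x\to\bar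 x,\,t\downarrow0}\frac{f(x+tv)-f(x)}{t}$ and the Clarke subdifferential is $\partial^\circ f(\bar x)=\{\zeta\in\mathbb{R}^n : \langle\zeta,v\rangle\le f^0(\bar x;v)\ \forall v\in\mathbb{R}^n\}$. A point $x^0$ is a critical point of $f$ if $0\in\partial^\circ f(x^0)$. An optimal solution is a global minimizer of $f$ on $\mathbb{R}^n$. *)

theory Defs
  imports "HOL-Analysis.Analysis"
begin

section \<open>Semi-algebraic subsets of a finite power of the reals\<close>

text \<open>For a finite index set \<open>I\<close>, the space of real vectors indexed by \<open>I\<close> is the set
  \<open>I \<rightarrow>\<^sub>E UNIV\<close> of extensional functions, the carrier of
  \<open>product_topology (\<lambda>_. euclideanreal) I\<close>.\<close>

definition polynomial_fun :: "'i set \<Rightarrow> (('i \<Rightarrow> real) \<Rightarrow> real) \<Rightarrow> bool" where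
  "polynomial_fun I p \<longleftrightarrow>
     (\<exists>(A :: ('i \<Rightarrow> nat) set) c. finite A \<and>
        p = (\<lambda>u. \<Sum>\<alpha>\<in>A. c \<alpha> * (\<Prod>i\<in>I. u i ^ \<alpha> i)))"

text \<open>A semi-algebraic set is a finite union of solution sets of finite systems of polynomial
  equations \<open>p = 0\<close> (\<open>p \<in> E\<close>) and strict inequalities \<open>p > 0\<close> (\<open>p \<in> P\<close>).\<close>

definition semialgebraic :: "'i set \<Rightarrow> ('i \<Rightarrow> real) set \<Rightarrow> bool" where
  "semialgebraic I S \<longleftrightarrow>
     (\<exists>\<F>. finite \<F> \<and>
        (\<forall>(E, P)\<in>\<F>. finite E \<and> finite P \<and> (\<forall>p\<in>E \<union> P. polynomial_fun I p)) \<and>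
        S = (\<Union>(E, P)\<in>\<F>.
               {u \<in> I \<rightarrow>\<^sub>E UNIV. (\<forall>p\<in>E. p u = 0) \<and> (\<forall>p\<in>P. p u > 0)}))"

section \<open>Families of polynomials and their continuous selections\<close>

definition multi_indices :: "nat \<Rightarrow> ('n::finite \<Rightarrow> nat) set" where
  "multi_indices d = {\<alpha>. (\<Sum>j\<in>UNIV. \<alpha> j) \<le> d}"

text \<open>A coefficient tuple \<open>u\<close> has the entry \<open>u (i, \<alpha>)\<close> as coefficient of the monomial
  \<open>x\<^sup>\<alpha>\<close> in the \<open>i\<close>-th polynomial, \<open>1 \<le> i \<le> r\<close>.\<close>

definition coeff_indices :: "nat \<Rightarrow> nat \<Rightarrow> (nat \<times> ('n::finite \<Rightarrow> nat)) set" where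
  "coeff_indices d r = {1..r} \<times> multi_indices d"

definition coeff_space :: "nat \<Rightarrow> nat \<Rightarrow> (nat \<times> ('n::finite \<Rightarrow> nat) \<Rightarrow> real) topology" where
  "coeff_space d r = product_topology (\<lambda>_. euclideanreal) (coeff_indices d r)"

definition poly_family ::
    "nat \<Rightarrow> (nat \<times> ('n::finite \<Rightarrow> nat) \<Rightarrow> real) \<Rightarrow> nat \<Rightarrow> real ^ 'n \<Rightarrow> real" where
  "poly_family d u i x = (\<Sum>\<alpha>\<in>multi_indices d. u (i, \<alpha>) * (\<Prod>j\<in>UNIV. (x $ j) ^ \<alpha> j))"

definition continuous_selections ::
    "nat \<Rightarrow> nat \<Rightarrow> (nat \<times> ('n::finite \<Rightarrow> nat) \<Rightarrow> real) \<Rightarrow> (real ^ 'n \<Rightarrow> real) set" where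
  "continuous_selections d r u =
     {f. continuous_on UNIV f \<and> (\<forall>x. f x \<in> (\<lambda>i. poly_family d u i x) ` {1..r})}"

section \<open>Clarke subdifferential\<close>

text \<open>The upper limit is taken over \<open>y \<rightarrow> x\<close> (with \<open>y = x\<close> allowed) and \<open>t \<down> 0\<close>, in the extended
  reals; it is finite if \<open>f\<close> is locally Lipschitz.\<close>

definition clarke_deriv :: "('a::real_inner \<Rightarrow> real) \<Rightarrow> 'a \<Rightarrow> 'a \<Rightarrow> ereal" where
  "clarke_deriv f x v =
     Limsup (nhds x \<times>\<^sub>F at_right 0) (\<lambda>(y, t). ereal ((f (y + t *\<^sub>R v) - f y) / t))"

definition clarke_subdifferential :: "('a::real_inner \<Rightarrow> real) \<Rightarrow> 'a \<Rightarrow> 'a set" where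
  "clarke_subdifferential f x = {\<zeta>. \<forall>v. ereal (\<zeta> \<bullet> v) \<le> clarke_deriv f x v}"

definition critical_point :: "('a::real_inner \<Rightarrow> real) \<Rightarrow> 'a \<Rightarrow> bool" where
  "critical_point f x \<longleftrightarrow> 0 \<in> clarke_subdifferential f x"

definition optimal_solution :: "('a \<Rightarrow> real) \<Rightarrow> 'a \<Rightarrow> bool" where
  "optimal_solution f x \<longleftrightarrow> (\<forall>y. f x \<le> f y)"

end

(* The coefficient tuples violating (a) all lie in the zero set of a single nonzero polynomial P,
   and U is the complement of that zero set; (b) follows from (a) because minimizers are critical.

   If x is critical for a continuous selection f with f x = c, then 0 is a convex combination, with
   weights L, of the gradients at x of the polynomials that are active at x, and by Caratheodory at
   most n + 1 of them are needed. Two critical points x, y with the same value c therefore give a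
   linear system for the coefficients u, whose matrix and right-hand side are polynomials in the
   parameters (x, y, L, L', c). It has more equations than parameters. Where its rows are independent,
   Gaussian elimination writes u as a rational function of fewer than dim u parameters,
   and counting dimensions of spaces of polynomials yields P.

   Normalize L i = 1 and L' j = 1. For d >= 3 the rows are always independent, and for d = 2 they are
   if L, L' are not proportional (L j * L' i ~= 1). If d = 2 and L = L', the weighted sum is critical
   along the whole line through x and y, which saves one parameter. For d = 1 only the condition that
   weighted sums of gradients vanish is kept, together with the value c of both weighted sums if
   L ~= L', or with the vanishing of the active gradients in the direction y - x if L = L'. *)

theory Submission
  imports Defs
begin

section \<open>Polynomial functions\<close>

subsection \<open>Functions that are polynomial in each variable\<close>

text \<open>The obstacle is that values and gradients at two points are not independent on
  polynomials of low degree. On quadratics the trapezoidal rule, f(y) - f(x) = half the inner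
  product of y - x with the sum of the gradients at x and y, is exact; for distinct points it is the
  only relation up to a factor, and cubics break it. For d = 2 and equal weights it makes the
  equality of the two critical values automatic. With a single active polynomial, parameters and
  independent equations then balance exactly, so the values at y are dropped and y is slid along the
  critical line instead.

  On affine polynomials the gradient does not see the point, so the points cannot stay among the
  parameters, and Caratheodory's bound becomes essential: two supports of at most n + 1 indices
  leave at most 2 n + 1 parameters against 2 n + 2 equations. In the other three counts the surplus
  is exactly one equation.

  The exceptional set is never described exactly. Only an enclosing hypersurface is constructed, so
  no quantifier elimination is needed.\<close>

text \<open>Being polynomial of degree at most \<open>E\<close> in each variable is expressed by the univariate
  restrictions, so that closure under sums and products needs no normal form.\<close>

definition poly_le :: "'v set \<Rightarrow> nat \<Rightarrow> (('v \<Rightarrow> real) \<Rightarrow> real) \<Rightarrow> bool" where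
  "poly_le V E p \<longleftrightarrow>
     (\<forall>z z'. (\<forall>v\<in>V. z v = z' v) \<longrightarrow> p z = p z') \<and>
     (\<forall>v z. \<exists>\<pi>. degree \<pi> \<le> E \<and> (\<forall>s. p (z(v := s)) = poly \<pi> s))"

definition poly_in :: "'v set \<Rightarrow> (('v \<Rightarrow> real) \<Rightarrow> real) \<Rightarrow> bool" where
  "poly_in V p \<longleftrightarrow> (\<exists>E. poly_le V E p)"

lemma poly_leE:
  assumes "poly_le V E p"
  obtains \<pi> where "degree \<pi> \<le> E" "\<And>s. p (z(v := s)) = poly \<pi> s"
proof -
  have "\<exists>\<pi>. degree \<pi> \<le> E \<and> (\<forall>s. p (z(v := s)) = poly \<pi> s)"
    using conjunct2[OF assms[unfolded poly_le_def]] by blast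
  then show ?thesis using that by blast
qed

lemma poly_le_cong: "poly_le V E p \<Longrightarrow> (\<And>v. v \<in> V \<Longrightarrow> z v = z' v) \<Longrightarrow> p z = p z'"
  unfolding poly_le_def by blast

lemma poly_le_mono: "poly_le V E p \<Longrightarrow> E \<le> E' \<Longrightarrow> poly_le V E' p"
  unfolding poly_le_def using order_trans by blast

lemma poly_le_const: "poly_le V E (\<lambda>z. c)"
  unfolding poly_le_def by (auto intro!: exI[of _ "[:c:]"])

lemma poly_le_var:
  assumes "v \<in> V" "E \<ge> 1"
  shows "poly_le V E (\<lambda>z. z v)"
  unfolding poly_le_def
proof (intro conjI allI impI)
  fix w :: 'a and z :: "'a \<Rightarrow> real"
  show "\<exists>\<pi>. degree \<pi> \<le> E \<and> (\<forall>s. (z(w := s)) v = poly \<pi> s)"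
  proof (cases "w = v")
    case True
    then show ?thesis using assms by (intro exI[of _ "[:0, 1:]"]) auto
  next
    case False
    then show ?thesis by (intro exI[of _ "[:z v:]"]) auto
  qed
qed (use assms in auto)

lemma poly_le_add:
  assumes "poly_le V E p" "poly_le V E q"
  shows "poly_le V E (\<lambda>z. p z + q z)"
  unfolding poly_le_def
proof (intro conjI allI impI)
  fix z z' :: "'a \<Rightarrow> real"
  assume "\<forall>v\<in>V. z v = z' v"
  then have "p z = p z'" "q z = q z'" using assms by (auto intro: poly_le_cong)
  then show "p z + q z = p z' + q z'" by simp
next
  fix w :: 'a and z :: "'a \<Rightarrow> real"
  obtain \<pi> where p: "degree \<pi> \<le> E" "\<And>s. p (z(w := s)) = poly \<pi> s"
    using assms(1) by (rule poly_leE[where z = z and v = w]) (rule that)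
  obtain \<rho> where q: "degree \<rho> \<le> E" "\<And>s. q (z(w := s)) = poly \<rho> s"
    using assms(2) by (rule poly_leE[where z = z and v = w]) (rule that)
  show "\<exists>\<pi>. degree \<pi> \<le> E \<and> (\<forall>s. p (z(w := s)) + q (z(w := s)) = poly \<pi> s)"
    using p q by (intro exI[of _ "\<pi> + \<rho>"]) (simp add: degree_add_le)
qed

lemma poly_le_mult:
  assumes "poly_le V E p" "poly_le V F q"
  shows "poly_le V (E + F) (\<lambda>z. p z * q z)"
  unfolding poly_le_def
proof (intro conjI allI impI)
  fix z z' :: "'a \<Rightarrow> real"
  assume "\<forall>v\<in>V. z v = z' v"
  then have "p z = p z'" "q z = q z'" using assms by (auto intro: poly_le_cong)
  then show "p z * q z = p z' * q z'" by simp
next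
  fix w :: 'a and z :: "'a \<Rightarrow> real"
  obtain \<pi> where p: "degree \<pi> \<le> E" "\<And>s. p (z(w := s)) = poly \<pi> s"
    using assms(1) by (rule poly_leE[where z = z and v = w]) (rule that)
  obtain \<rho> where q: "degree \<rho> \<le> F" "\<And>s. q (z(w := s)) = poly \<rho> s"
    using assms(2) by (rule poly_leE[where z = z and v = w]) (rule that)
  show "\<exists>\<pi>. degree \<pi> \<le> E + F \<and> (\<forall>s. p (z(w := s)) * q (z(w := s)) = poly \<pi> s)"
    using p q degree_mult_le[of \<pi> \<rho>] by (intro exI[of _ "\<pi> * \<rho>"]) simp
qed

lemma poly_le_cmult: "poly_le V E p \<Longrightarrow> poly_le V E (\<lambda>z. c * p z)"
  using poly_le_mult[OF poly_le_const[of V 0 c]] by simp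

lemma poly_le_sum: "(\<And>x. x \<in> X \<Longrightarrow> poly_le V E (p x)) \<Longrightarrow> poly_le V E (\<lambda>z. \<Sum>x\<in>X. p x z)"
  by (induction X rule: infinite_finite_induct) (auto intro: poly_le_const poly_le_add)

lemma poly_le_prod:
  "finite X \<Longrightarrow> (\<And>x. x \<in> X \<Longrightarrow> poly_le V E (p x)) \<Longrightarrow>
     poly_le V (card X * E) (\<lambda>z. \<Prod>x\<in>X. p x z)"
proof (induction X rule: finite_induct)
  case (insert x X)
  then have "poly_le V (E + card X * E) (\<lambda>z. p x z * (\<Prod>x\<in>X. p x z))"
    by (intro poly_le_mult) auto
  then show ?case using insert by simp
qed (simp add: poly_le_const)

lemma poly_in_const [intro]: "poly_in V (\<lambda>z. c)"
  unfolding poly_in_def by (rule exI) (rule poly_le_const[of _ 0])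

lemma poly_in_var [intro]: "v \<in> V \<Longrightarrow> poly_in V (\<lambda>z. z v)"
  unfolding poly_in_def by (rule exI) (rule poly_le_var[OF _ order_refl])

lemma poly_in_add [intro]:
  assumes "poly_in V p" "poly_in V q"
  shows "poly_in V (\<lambda>z. p z + q z)"
proof -
  obtain E F where "poly_le V E p" "poly_le V F q" using assms unfolding poly_in_def by blast
  then have "poly_le V (max E F) (\<lambda>z. p z + q z)"
    by (intro poly_le_add) (auto elim: poly_le_mono)
  then show ?thesis unfolding poly_in_def by blast
qed

lemma poly_in_mult [intro]: "poly_in V p \<Longrightarrow> poly_in V q \<Longrightarrow> poly_in V (\<lambda>z. p z * q z)"
  unfolding poly_in_def by (elim exE) (rule exI, rule poly_le_mult)

lemma poly_in_diff [intro]: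
  assumes "poly_in V p" "poly_in V q"
  shows "poly_in V (\<lambda>z. p z - q z)"
proof -
  have "poly_in V (\<lambda>z. p z + (- 1) * q z)"
    using assms by (intro poly_in_add poly_in_mult poly_in_const)
  then show ?thesis by simp
qed

lemma poly_in_sum [intro]: "(\<And>x. x \<in> X \<Longrightarrow> poly_in V (p x)) \<Longrightarrow> poly_in V (\<lambda>z. \<Sum>x\<in>X. p x z)"
  by (induction X rule: infinite_finite_induct) auto

lemma poly_in_prod [intro]: "(\<And>x. x \<in> X \<Longrightarrow> poly_in V (p x)) \<Longrightarrow> poly_in V (\<lambda>z. \<Prod>x\<in>X. p x z)"
  by (induction X rule: infinite_finite_induct) auto

lemma poly_in_power [intro]: "poly_in V p \<Longrightarrow> poly_in V (\<lambda>z. p z ^ k)"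
  by (induction k) auto

text \<open>Coefficients that depend on the parameters in \<open>V\<close> are reused after unknowns
  in \<open>W\<close> have been adjoined as further variables.\<close>

lemma poly_in_comp_Inl:
  assumes "poly_in V p"
  shows "poly_in (V <+> W) (\<lambda>z. p (z \<circ> Inl))"
proof -
  obtain E where E: "poly_le V E p" using assms unfolding poly_in_def by blast
  have "poly_le (V <+> W) E (\<lambda>z. p (z \<circ> Inl))"
    unfolding poly_le_def
  proof (intro conjI allI impI)
    fix z z' :: "'a + 'b \<Rightarrow> real"
    assume "\<forall>v\<in>V <+> W. z v = z' v"
    then show "p (z \<circ> Inl) = p (z' \<circ> Inl)"
      by (intro poly_le_cong[OF E]) auto
  next
    fix v :: "'a + 'b" and z :: "'a + 'b \<Rightarrow> real"
    show "\<exists>\<pi>. degree \<pi> \<le> E \<and> (\<forall>s. p (z(v := s) \<circ> Inl) = poly \<pi> s)"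
    proof (cases v)
      case (Inl a)
      then have *: "z(v := s) \<circ> Inl = (z \<circ> Inl)(a := s)" for s by (simp add: fun_eq_iff)
      obtain \<pi> where "degree \<pi> \<le> E" "\<And>s. p ((z \<circ> Inl)(a := s)) = poly \<pi> s"
        using E by (rule poly_leE[where z = "z \<circ> Inl" and v = a]) (rule that)
      then show ?thesis unfolding * by blast
    next
      case (Inr b)
      then have "z(v := s) \<circ> Inl = z \<circ> Inl" for s by (simp add: fun_eq_iff)
      then show ?thesis by (intro exI[of _ "[:p (z \<circ> Inl):]"]) simp
    qed
  qed
  then show ?thesis unfolding poly_in_def by blast
qed

text \<open>A univariate polynomial of degree at most \<open>E\<close> with the \<open>E + 1\<close>
  roots 0, ..., E is zero; the coordinates are released from the grid one at a time.\<close>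

lemma poly_le_zero_if_zero_on_grid:
  assumes "finite V" and p: "poly_le V E p"
    and zero: "\<And>z. z \<in> V \<rightarrow> real ` {..E} \<Longrightarrow> p z = 0"
  shows "p z = 0"
proof -
  \<comment> \<open>\<open>S\<close> is the set of coordinates already released from the
    grid.\<close>
  have "S \<subseteq> V \<Longrightarrow> (\<And>z. z \<in> (V - S) \<rightarrow> real ` {..E} \<Longrightarrow> p z = 0)" if "finite S" for S
    using that
  proof (induction S rule: finite_induct)
    case empty
    then show ?case using zero by simp
  next
    case (insert v S)
    obtain \<pi> where \<pi>: "degree \<pi> \<le> E" "\<And>s. p (z(v := s)) = poly \<pi> s"
      using p by (rule poly_leE[where z = z and v = v]) (rule that)
    have root: "poly \<pi> (real k) = 0" if "k \<le> E" for k
    proof -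
      have "z(v := real k) \<in> (V - S) \<rightarrow> real ` {..E}"
        using insert.prems(2) that by (auto simp: Pi_iff)
      then have "p (z(v := real k)) = 0" using insert.IH insert.prems(1) by blast
      then show ?thesis using \<pi>(2) by simp
    qed
    have "\<pi> = 0"
    proof (rule ccontr)
      assume "\<pi> \<noteq> 0"
      then have "card {s. poly \<pi> s = 0} \<le> degree \<pi>"
        by (rule card_poly_roots_bound)
      moreover have fin: "finite {s. poly \<pi> s = 0}"
        using \<open>\<pi> \<noteq> 0\<close> by (rule poly_roots_finite)
      moreover have "card (real ` {..E}) \<le> card {s. poly \<pi> s = 0}"
        using root by (intro card_mono[OF fin]) auto
      ultimately show False
        using \<pi>(1) by (simp add: card_image)
    qed
    then show ?case using \<pi>(2)[of "z v"] by simp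
  qed
  from this[OF assms(1) order_refl] show ?thesis by simp
qed

text \<open>Induction on the equations: an unknown \<open>h\<close> that occurs in equation
  \<open>b\<close> is eliminated, which costs one equation and one unknown.\<close>

lemma underdetermined_system:
  fixes a :: "'g \<Rightarrow> 'b \<Rightarrow> real"
  assumes "finite B" "finite G" "card B < card G"
  shows "\<exists>c. (\<exists>g\<in>G. c g \<noteq> 0) \<and> (\<forall>b\<in>B. (\<Sum>g\<in>G. c g * a g b) = 0)"
  using assms
proof (induction B arbitrary: G a rule: finite_induct)
  case empty
  then have "G \<noteq> {}" by auto
  then show ?case by (intro exI[of _ "\<lambda>_. 1"]) auto
next
  case (insert b B)
  show ?case
  proof (cases "\<forall>g\<in>G. a g b = 0")
    case True
    obtain c where "\<exists>g\<in>G. c g \<noteq> 0" "\<forall>b\<in>B. (\<Sum>g\<in>G. c g * a g b) = 0"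
      using insert.IH[of G a] insert.prems insert.hyps by auto
    then show ?thesis using True by (intro exI[of _ c]) auto
  next
    case False
    then obtain h where h: "h \<in> G" "a h b \<noteq> 0" by blast
    have "card B < card (G - {h})" using insert h by simp
    then obtain c where c: "\<exists>g\<in>G - {h}. c g \<noteq> 0"
      "\<And>e. e \<in> B \<Longrightarrow> (\<Sum>g\<in>G - {h}. c g * (a g e - a g b / a h b * a h e)) = 0"
      using insert.IH[of "G - {h}" "\<lambda>g e. a g e - a g b / a h b * a h e"] insert.prems by auto
    define s where "s = (\<Sum>g\<in>G - {h}. c g * a g b)"
    define c' where "c' = c(h := - s / a h b)"
    have split: "(\<Sum>g\<in>G. c' g * a g e) = - s / a h b * a h e + (\<Sum>g\<in>G - {h}. c g * a g e)" for e
      unfolding c'_def using h insert.prems by (subst sum.remove[of _ h]) auto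
    have "(\<Sum>g\<in>G. c' g * a g e) = 0" if "e \<in> B" for e
    proof -
      have "0 = (\<Sum>g\<in>G - {h}. c g * a g e - c g * a g b * (a h e / a h b))"
        using c(2)[OF that] by (simp add: algebra_simps)
      also have "\<dots> = (\<Sum>g\<in>G - {h}. c g * a g e) - s * (a h e / a h b)"
        by (simp only: sum_subtractf s_def sum_distrib_right)
      finally show ?thesis unfolding split by simp
    qed
    moreover have "(\<Sum>g\<in>G. c' g * a g b) = 0"
      unfolding split using h by (simp add: s_def)
    moreover have "\<exists>g\<in>G. c' g \<noteq> 0" using c(1) by (auto simp: c'_def)
    ultimately show ?thesis by (intro exI[of _ c']) auto
  qed
qed

subsection \<open>Polynomial functions with explicit coefficients\<close>

text \<open>\<open>K\<close> is an arbitrary index set and \<open>e\<close> may repeat a monomial,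
  so the rules for sums and products need not collect like terms.\<close>

lemma polynomial_funI:
  assumes "finite K" "\<And>u. p u = (\<Sum>k\<in>K. c k * (\<Prod>i\<in>I. u i ^ e k i))"
  shows "polynomial_fun I p"
  unfolding polynomial_fun_def
proof (intro exI conjI)
  show "finite (e ` K)" using assms by simp
  have "p u = (\<Sum>\<alpha>\<in>e ` K. (\<Sum>k\<in>{k\<in>K. e k = \<alpha>}. c k) * (\<Prod>i\<in>I. u i ^ \<alpha> i))" for u
  proof -
    have "p u = (\<Sum>\<alpha>\<in>e ` K. \<Sum>k\<in>{k\<in>K. e k = \<alpha>}. c k * (\<Prod>i\<in>I. u i ^ e k i))"
      unfolding assms(2) by (rule sum.image_gen[OF assms(1)])
    also have "\<dots> = (\<Sum>\<alpha>\<in>e ` K. \<Sum>k\<in>{k\<in>K. e k = \<alpha>}. c k * (\<Prod>i\<in>I. u i ^ \<alpha> i))"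
      by (intro sum.cong) auto
    finally show ?thesis by (simp add: sum_distrib_right)
  qed
  then show "p = (\<lambda>u. \<Sum>\<alpha>\<in>e ` K. (\<Sum>k\<in>{k\<in>K. e k = \<alpha>}. c k) * (\<Prod>i\<in>I. u i ^ \<alpha> i))"
    by blast
qed

lemma polynomial_funE:
  assumes "polynomial_fun I p"
  obtains A c where "finite A" "\<And>u. p u = (\<Sum>\<alpha>\<in>A. c \<alpha> * (\<Prod>i\<in>I. u i ^ \<alpha> i))"
  using assms unfolding polynomial_fun_def by auto

lemma polynomial_fun_const [intro]: "polynomial_fun I (\<lambda>u. c)"
  by (rule polynomial_funI[where K = "{()}" and c = "\<lambda>_. c" and e = "\<lambda>_ _. 0"]) auto

lemma polynomial_fun_var [intro]:
  assumes "finite I" "j \<in> I"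
  shows "polynomial_fun I (\<lambda>u. u j)"
proof (rule polynomial_funI[where K = "{()}" and c = "\<lambda>_. 1" and e = "\<lambda>_ i. if i = j then 1 else 0"])
  fix u :: "'a \<Rightarrow> real"
  have "(\<Prod>i\<in>I. u i ^ (if i = j then 1 else 0)) = (\<Prod>i\<in>I. if i = j then u i else 1)"
    by (intro prod.cong) auto
  then show "u j = (\<Sum>k\<in>{()}. 1 * (\<Prod>i\<in>I. u i ^ (if i = j then 1 else 0)))"
    using assms by simp
qed simp

lemma polynomial_fun_add [intro]:
  assumes "polynomial_fun I p" "polynomial_fun I q"
  shows "polynomial_fun I (\<lambda>u. p u + q u)"
proof -
  obtain A c where A: "finite A" "\<And>u. p u = (\<Sum>\<alpha>\<in>A. c \<alpha> * (\<Prod>i\<in>I. u i ^ \<alpha> i))"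
    using assms(1) by (rule polynomial_funE) (rule that)
  obtain B d where B: "finite B" "\<And>u. q u = (\<Sum>\<alpha>\<in>B. d \<alpha> * (\<Prod>i\<in>I. u i ^ \<alpha> i))"
    using assms(2) by (rule polynomial_funE) (rule that)
  show ?thesis
    by (rule polynomial_funI[where K = "A <+> B" and c = "case_sum c d" and e = "case_sum id id"])
       (simp_all add: A B sum.Plus)
qed

lemma polynomial_fun_mult [intro]:
  assumes "polynomial_fun I p" "polynomial_fun I q"
  shows "polynomial_fun I (\<lambda>u. p u * q u)"
proof -
  obtain A c where A: "finite A" "\<And>u. p u = (\<Sum>\<alpha>\<in>A. c \<alpha> * (\<Prod>i\<in>I. u i ^ \<alpha> i))"
    using assms(1) by (rule polynomial_funE) (rule that)
  obtain B d where B: "finite B" "\<And>u. q u = (\<Sum>\<alpha>\<in>B. d \<alpha> * (\<Prod>i\<in>I. u i ^ \<alpha> i))"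
    using assms(2) by (rule polynomial_funE) (rule that)
  show ?thesis
  proof (rule polynomial_funI[where K = "A \<times> B" and c = "\<lambda>(\<alpha>, \<beta>). c \<alpha> * d \<beta>" and
      e = "\<lambda>(\<alpha>, \<beta>) i. \<alpha> i + \<beta> i"])
    fix u
    show "p u * q u = (\<Sum>k\<in>A \<times> B. (case k of (\<alpha>, \<beta>) \<Rightarrow> c \<alpha> * d \<beta>) *
        (\<Prod>i\<in>I. u i ^ (case k of (\<alpha>, \<beta>) \<Rightarrow> \<lambda>i. \<alpha> i + \<beta> i) i))"
      unfolding A B sum_product sum.cartesian_product
      by (intro sum.cong) (auto simp: power_add prod.distrib)
  qed (use A B in simp)
qed

lemma polynomial_fun_sum [intro]:
  "(\<And>x. x \<in> X \<Longrightarrow> polynomial_fun I (p x)) \<Longrightarrow> polynomial_fun I (\<lambda>u. \<Sum>x\<in>X. p x u)"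
  by (induction X rule: infinite_finite_induct) auto

lemma polynomial_fun_prod [intro]:
  "(\<And>x. x \<in> X \<Longrightarrow> polynomial_fun I (p x)) \<Longrightarrow> polynomial_fun I (\<lambda>u. \<Prod>x\<in>X. p x u)"
  by (induction X rule: infinite_finite_induct) auto

lemma polynomial_fun_on_line:
  assumes "polynomial_fun I p"
  shows "\<exists>\<pi>. \<forall>s. p (\<lambda>i. a i + s * b i) = poly \<pi> s"
proof -
  obtain A c where A: "finite A" "\<And>u. p u = (\<Sum>\<alpha>\<in>A. c \<alpha> * (\<Prod>i\<in>I. u i ^ \<alpha> i))"
    using assms by (rule polynomial_funE) (rule that)
  show ?thesis
    by (rule exI[of _ "\<Sum>\<alpha>\<in>A. smult (c \<alpha>) (\<Prod>i\<in>I. [:a i, b i:] ^ \<alpha> i)"])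
       (simp add: A(2) poly_sum poly_prod)
qed

lemma polynomial_fun_cong:
  assumes "polynomial_fun I p" "\<And>i. i \<in> I \<Longrightarrow> u i = v i"
  shows "p u = p v"
proof -
  obtain A c where A: "finite A" "\<And>u. p u = (\<Sum>\<alpha>\<in>A. c \<alpha> * (\<Prod>i\<in>I. u i ^ \<alpha> i))"
    using assms(1) by (rule polynomial_funE) (rule that)
  show ?thesis unfolding A(2) using assms(2) by simp
qed

lemma continuous_map_polynomial_fun:
  assumes "finite I" "polynomial_fun I p"
  shows "continuous_map (product_topology (\<lambda>_. euclideanreal) I) euclideanreal p"
proof -
  obtain A c where A: "finite A" "\<And>u. p u = (\<Sum>\<alpha>\<in>A. c \<alpha> * (\<Prod>i\<in>I. u i ^ \<alpha> i))"
    using assms(2) by (rule polynomial_funE) (rule that)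
  have var: "continuous_map (product_topology (\<lambda>_. euclideanreal) I) euclideanreal (\<lambda>u. u i)"
    if "i \<in> I" for i
    using that by (rule continuous_map_product_projection)
  have "continuous_map (product_topology (\<lambda>_. euclideanreal) I) euclideanreal
     (\<lambda>u. \<Sum>\<alpha>\<in>A. c \<alpha> * (\<Prod>i\<in>I. u i ^ \<alpha> i))"
  proof (intro continuous_map_sum continuous_map_real_mult continuous_map_prod
        continuous_map_real_pow)
    show "continuous_map (product_topology (\<lambda>_. euclideanreal) I) euclideanreal (\<lambda>u. c \<alpha>)" for \<alpha>
      by simp
  qed (use A assms(1) var in auto)
  moreover have "p = (\<lambda>u. \<Sum>\<alpha>\<in>A. c \<alpha> * (\<Prod>i\<in>I. u i ^ \<alpha> i))"
    using A(2) by blast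
  ultimately show ?thesis by simp
qed

section \<open>Sets contained in an algebraic hypersurface\<close>

text \<open>The witness \<open>u\<close> need not be extensional: by
  \<open>polynomial_fun_cong\<close> only its entries in \<open>I\<close> matter, so points on
  arbitrary lines can serve.\<close>

definition alg_null :: "'i set \<Rightarrow> ('i \<Rightarrow> real) set \<Rightarrow> bool" where
  "alg_null I B \<longleftrightarrow> (\<exists>P. polynomial_fun I P \<and> (\<exists>u. P u \<noteq> 0) \<and> (\<forall>u\<in>B. P u = 0))"

lemma alg_null_subset: "alg_null I B \<Longrightarrow> A \<subseteq> B \<Longrightarrow> alg_null I A"
  unfolding alg_null_def by blast

lemma alg_null_empty: "alg_null I {}"
  unfolding alg_null_def by (rule exI[of _ "\<lambda>_. 1"]) auto

text \<open>At \<open>s = 1\<close> the line reaches \<open>a\<close>, so \<open>P\<close> restricts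
  to a nonzero univariate polynomial. This serves both for products of nonzero polynomials and for
  density.\<close>

lemma nonzero_on_line:
  assumes "polynomial_fun I P" "P a \<noteq> 0"
  shows "finite {s. P (\<lambda>i. u i + s * (a i - u i)) = 0}"
proof -
  obtain \<pi> where \<pi>: "\<And>s. P (\<lambda>i. u i + s * (a i - u i)) = poly \<pi> s"
    using polynomial_fun_on_line[OF assms(1), of u "\<lambda>i. a i - u i"] by blast
  have "poly \<pi> 1 \<noteq> 0" using \<pi>[of 1] assms(2) by simp
  then have "\<pi> \<noteq> 0" by auto
  then show ?thesis unfolding \<pi> by (rule poly_roots_finite)
qed

text \<open>The product of \<open>P\<close> and \<open>Q\<close> works: on the line through
  \<open>a\<close> and \<open>b\<close> both factors have finitely many zeros, so some point avoids
  them all.\<close>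

lemma alg_null_Un:
  assumes "alg_null I A" "alg_null I B"
  shows "alg_null I (A \<union> B)"
proof -
  obtain P a where P: "polynomial_fun I P" "P a \<noteq> 0" "\<forall>u\<in>A. P u = 0"
    using assms(1) unfolding alg_null_def by blast
  obtain Q b where Q: "polynomial_fun I Q" "Q b \<noteq> 0" "\<forall>u\<in>B. Q u = 0"
    using assms(2) unfolding alg_null_def by blast
  let ?l = "\<lambda>s i. a i + s * (b i - a i)"
  have "finite {s. Q (?l s) = 0}"
    using Q by (intro nonzero_on_line)
  moreover have "finite {s. P (?l s) = 0}"
  proof -
    \<comment> \<open>Traversed backwards from \<open>b\<close>, the line ends at \<open>a\<close>,
      where \<open>P\<close> does not vanish.\<close>
    have "?l s = (\<lambda>i. b i + (1 - s) * (a i - b i))" for s by (auto simp: algebra_simps)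
    moreover have "finite {s. P (\<lambda>i. b i + s * (a i - b i)) = 0}"
      using P by (intro nonzero_on_line)
    then have "finite ((\<lambda>s. 1 - s) -` {s. P (\<lambda>i. b i + s * (a i - b i)) = 0})"
      by (intro finite_vimageI) (auto intro: injI)
    ultimately show ?thesis by (simp add: vimage_def)
  qed
  ultimately have "finite ({s. P (?l s) = 0} \<union> {s. Q (?l s) = 0})" by simp
  then obtain s :: real where "s \<notin> {s. P (?l s) = 0} \<union> {s. Q (?l s) = 0}"
    using ex_new_if_finite[OF infinite_UNIV_char_0] by blast
  then have "P (?l s) * Q (?l s) \<noteq> 0" by simp
  then show ?thesis
    unfolding alg_null_def using P Q
    by (intro exI[of _ "\<lambda>u. P u * Q u"]) (auto intro!: exI[of _ "?l s"])
qed

lemma alg_null_UN: "finite X \<Longrightarrow> (\<And>x. x \<in> X \<Longrightarrow> alg_null I (B x)) \<Longrightarrow> alg_null I (\<Union>x\<in>X. B x)"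
  by (induction X rule: finite_induct) (auto intro: alg_null_Un alg_null_empty)

lemma alg_null_avoided_by_open_dense_semialgebraic:
  assumes "finite I" "alg_null I B"
  shows "\<exists>U. openin (product_topology (\<lambda>_. euclideanreal) I) U \<and>
    product_topology (\<lambda>_. euclideanreal) I closure_of U =
      topspace (product_topology (\<lambda>_. euclideanreal) I) \<and>
    semialgebraic I U \<and> U \<inter> B = {}"
proof -
  let ?X = "product_topology (\<lambda>_. euclideanreal) I"
  obtain P a where P: "polynomial_fun I P" "P a \<noteq> 0" "\<forall>u\<in>B. P u = 0"
    using assms(2) unfolding alg_null_def by blast
  define U where "U = {u \<in> I \<rightarrow>\<^sub>E UNIV. P u \<noteq> 0}"
  have "openin ?X {u \<in> topspace ?X. P u \<in> - {0}}"
    using continuous_map_polynomial_fun[OF assms(1) P(1)]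
    by (rule openin_continuous_map_preimage) auto
  then have "openin ?X U" by (simp add: U_def)
  moreover have "topspace ?X \<subseteq> ?X closure_of U"
  proof
    fix u assume u: "u \<in> topspace ?X"
    show "u \<in> ?X closure_of U"
      unfolding in_closure_of
    proof (intro conjI allI impI)
      fix T assume T: "u \<in> T \<and> openin ?X T"
      \<comment> \<open>Restriction keeps the line inside the carrier of extensional
        functions.\<close>
      define l where "l s = restrict (\<lambda>i. u i + s * (a i - u i)) I" for s :: real
      have "continuous_map euclideanreal ?X l"
        unfolding continuous_map_componentwise l_def
        by (auto simp: continuous_map_iff_continuous2 intro!: continuous_intros)
      then have "openin euclideanreal {s \<in> topspace euclideanreal. l s \<in> T}"
        using T by (intro openin_continuous_map_preimage) auto
      then have "open {s. l s \<in> T}" by simp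
      moreover have "l 0 = u"
        using u by (auto simp: l_def fun_eq_iff PiE_def extensional_def)
      then have "0 \<in> {s. l s \<in> T}" using T by simp
      ultimately obtain e where e: "e > 0" "ball 0 e \<subseteq> {s. l s \<in> T}"
        by (meson open_contains_ball)
      have "infinite {0<..<e}" using e(1) by (rule infinite_Ioo)
      moreover have "finite {s. P (\<lambda>i. u i + s * (a i - u i)) = 0}"
        by (rule nonzero_on_line[where P = P and a = a and u = u, OF P(1,2)])
      ultimately have "\<not> {0<..<e} \<subseteq> {s. P (\<lambda>i. u i + s * (a i - u i)) = 0}"
        by (metis finite_subset)
      then obtain s where s: "s \<in> {0<..<e}" "P (\<lambda>i. u i + s * (a i - u i)) \<noteq> 0" by blast
      moreover have "P (l s) = P (\<lambda>i. u i + s * (a i - u i))"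
        by (rule polynomial_fun_cong[OF P(1)]) (simp add: l_def)
      ultimately have "l s \<in> U" by (simp add: U_def l_def)
      moreover have "s \<in> ball 0 e" using s(1) by simp
      then have "l s \<in> T" using e(2) by blast
      ultimately show "\<exists>y. y \<in> U \<and> y \<in> T" by blast
    qed (rule u)
  qed
  then have "?X closure_of U = topspace ?X"
    by (intro subset_antisym closure_of_subset_topspace)
  moreover have "semialgebraic I U"
  proof -
    \<comment> \<open>\<open>semialgebraic\<close> offers only equations and strict inequalities, so
      the disequation is coded by a positive square.\<close>
    have "P u \<noteq> 0 \<longleftrightarrow> P u * P u > 0" for u
      by (metis mult_eq_0_iff not_real_square_gt_zero)
    then have "U = (\<Union>(E, Q)\<in>{({}, {\<lambda>u. P u * P u})}.
        {u \<in> I \<rightarrow>\<^sub>E UNIV. (\<forall>p\<in>E. p u = 0) \<and> (\<forall>p\<in>Q. p u > 0)})"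
      unfolding U_def by auto
    then show ?thesis
      unfolding semialgebraic_def using P(1)
      by (intro exI[of _ "{({}, {\<lambda>u. P u * P u})}"]) auto
  qed
  moreover have "U \<inter> B = {}" using P(3) by (auto simp: U_def)
  ultimately show ?thesis by blast
qed

subsection \<open>Rational images of lower-dimensional spaces\<close>

text \<open>The right side wins by its larger exponent. \<open>D\<close> is chosen as exactly the
  factor that is left over when the base on the left is bounded by
  \<open>N * K * (D + 1)\<close>.\<close>

lemma grid_count:
  fixes K N m :: nat
  assumes "K \<ge> 1" "m < N"
  shows "\<exists>D. (N * (D * K) + 1) ^ m < (D + 1) ^ N"
proof
  define D where "D = (N * K) ^ m"
  have NK: "1 \<le> N * K" using assms by simp
  have "N * (D * K) + 1 \<le> N * K * (D + 1)"
    using NK by (simp add: algebra_simps)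
  then have "(N * (D * K) + 1) ^ m \<le> (N * K * (D + 1)) ^ m"
    by (rule power_mono) simp
  also have "\<dots> = D * (D + 1) ^ m"
    unfolding D_def by (rule power_mult_distrib)
  also have "\<dots> < (D + 1) ^ (m + 1)"
    by simp
  also have "\<dots> \<le> (D + 1) ^ N"
    using assms by (intro power_increasing) auto
  finally show "(N * (D * K) + 1) ^ m < (D + 1) ^ N" .
qed

text \<open>The polynomial vanishing on the image is sought in the span of the tensor products of
  Lagrange basis polynomials for the nodes \<open>0, \<dots>, D\<close>. For large \<open>D\<close> this span has larger
  dimension than the space of possible compositions with the parametrization, and a nontrivial
  combination does not vanish at the grid points that carry its nonzero coefficients.\<close>

lemma alg_null_rational_image:
  assumes "finite V" "finite I" "card V < card I" "poly_in V q" "\<And>i. i \<in> I \<Longrightarrow> poly_in V (n i)"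
  shows "alg_null I {u. \<exists>z. q z \<noteq> 0 \<and> (\<forall>i\<in>I. u i * q z = n i z)}"
proof -
  obtain F where F: "poly_le V F q" using assms(4) unfolding poly_in_def by blast
  obtain E where E: "\<And>i. i \<in> I \<Longrightarrow> poly_le V (E i) (n i)"
    using assms(5) unfolding poly_in_def by metis
  \<comment> \<open>One degree bound for the denominator and all numerators; the summand 1 provides
    \<open>K \<ge> 1\<close> for \<open>grid_count\<close>.\<close>
  define K where "K = 1 + F + (\<Sum>i\<in>I. E i)"
  have q: "poly_le V K q" by (rule poly_le_mono[OF F]) (simp add: K_def)
  have n: "poly_le V K (n i)" if "i \<in> I" for i
  proof (rule poly_le_mono[OF E[OF that]])
    have "E i \<le> (\<Sum>i\<in>I. E i)" using assms(2) that by (simp add: member_le_sum)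
    then show "E i \<le> K" by (simp add: K_def)
  qed
  define N where "N = card I"
  obtain D where D: "(N * (D * K) + 1) ^ card V < (D + 1) ^ N"
    using grid_count[of K "card V" N] assms(3) unfolding N_def K_def by auto
  define G where "G = (I \<rightarrow>\<^sub>E {..D})"
  define B where "B = (V \<rightarrow>\<^sub>E real ` {..N * (D * K)})"
  \<comment> \<open>\<open>M g\<close> is the tensor product of Lagrange basis polynomials for the
    node \<open>g\<close>; \<open>L g\<close> is its composition with the parametrization, each
    factor multiplied by \<open>q z\<close> to clear the denominator.\<close>
  define L where "L g z = (\<Prod>i\<in>I. \<Prod>b\<in>{..D} - {g i}. inverse (real (g i) - real b) * (n i z - real b * q z))"
    for g z
  define M where "M g u = (\<Prod>i\<in>I. \<Prod>b\<in>{..D} - {g i}. inverse (real (g i) - real b) * (u i - real b))"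
    for g u
  have "finite G" "finite B" using assms(1,2) by (auto simp: G_def B_def intro: finite_PiE)
  \<comment> \<open>The points of \<open>B\<close> are the vanishing conditions, the elements of
    \<open>G\<close> the free coefficients.\<close>
  moreover have "card B < card G"
    using D assms(1,2) by (simp add: G_def B_def card_PiE card_image N_def)
  ultimately obtain c where c: "\<exists>g\<in>G. c g \<noteq> 0" "\<And>z. z \<in> B \<Longrightarrow> (\<Sum>g\<in>G. c g * L g z) = 0"
    using underdetermined_system[of B G L] by blast
  have L: "poly_le V (N * (D * K)) (L g)" if "g \<in> G" for g
    unfolding L_def N_def
  proof (rule poly_le_prod[OF assms(2)])
    fix i assume i: "i \<in> I"
    then have "g i \<le> D" using that by (auto simp: G_def)
    then have "card ({..D} - {g i}) = D" by simp
    moreover have "poly_le V K (\<lambda>z. inverse (real (g i) - real b) * (n i z - real b * q z))" for b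
    proof -
      have "poly_le V K (\<lambda>z. n i z + (- real b) * q z)"
        by (intro poly_le_add n i poly_le_cmult q)
      then show ?thesis by (intro poly_le_cmult) simp
    qed
    then have "poly_le V (card ({..D} - {g i}) * K)
        (\<lambda>z. \<Prod>b\<in>{..D} - {g i}. inverse (real (g i) - real b) * (n i z - real b * q z))"
      by (intro poly_le_prod) auto
    ultimately show "poly_le V (D * K)
        (\<lambda>z. \<Prod>b\<in>{..D} - {g i}. inverse (real (g i) - real b) * (n i z - real b * q z))"
      by simp
  qed
  then have H: "poly_le V (N * (D * K)) (\<lambda>z. \<Sum>g\<in>G. c g * L g z)"
    by (intro poly_le_sum poly_le_cmult)
  have zero: "(\<Sum>g\<in>G. c g * L g z) = 0" for z
  proof (rule poly_le_zero_if_zero_on_grid[OF assms(1) H])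
    fix z assume "z \<in> V \<rightarrow> real ` {..N * (D * K)}"
    then have "restrict z V \<in> B" by (auto simp: B_def)
    then have "(\<Sum>g\<in>G. c g * L g (restrict z V)) = 0" by (rule c)
    moreover have "(\<Sum>g\<in>G. c g * L g z) = (\<Sum>g\<in>G. c g * L g (restrict z V))"
      by (rule poly_le_cong[OF H]) simp
    ultimately show "(\<Sum>g\<in>G. c g * L g z) = 0" by simp
  qed
  obtain h where h: "h \<in> G" "c h \<noteq> 0" using c(1) by blast
  show ?thesis
    unfolding alg_null_def
  proof (intro exI conjI ballI)
    show "polynomial_fun I (\<lambda>u. \<Sum>g\<in>G. c g * M g u)"
    proof (rule polynomial_fun_sum)
      fix g
      have "polynomial_fun I (\<lambda>u. inverse (real (g i) - real b) * (u i - real b))" if "i \<in> I" for i b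
      proof -
        have "polynomial_fun I (\<lambda>u. inverse (real (g i) - real b) * (u i + - real b))"
          by (intro polynomial_fun_mult polynomial_fun_const polynomial_fun_add
              polynomial_fun_var assms(2) that)
        then show ?thesis by simp
      qed
      then have "polynomial_fun I (M g)"
        unfolding M_def by (rule polynomial_fun_prod[OF polynomial_fun_prod])
      then show "polynomial_fun I (\<lambda>u. c g * M g u)"
        by (rule polynomial_fun_mult[OF polynomial_fun_const])
    qed
    \<comment> \<open>On the grid \<open>M\<close> is a Kronecker delta, so the combination takes
      the value \<open>c h\<close> at \<open>h\<close>.\<close>
    have "M g (\<lambda>i. real (h i)) = (if g = h then 1 else 0)" if "g \<in> G" for g
    proof (cases "g = h")
      case True
      have "(\<Prod>b\<in>{..D} - {h i}. inverse (real (h i) - real b) * (real (h i) - real b)) = 1" for i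
        by (intro prod.neutral) auto
      then show ?thesis using True by (simp add: M_def)
    next
      case False
      have "\<exists>i\<in>I. g i \<noteq> h i"
      proof (rule ccontr)
        assume "\<not> ?thesis"
        then have "g = h"
          by (intro PiE_ext[OF that[unfolded G_def] h(1)[unfolded G_def]]) simp
        then show False using False by simp
      qed
      then obtain i where i: "i \<in> I" "g i \<noteq> h i" by blast
      moreover have "h i \<le> D" using h(1) i(1) by (auto simp: G_def)
      ultimately have "(\<Prod>b\<in>{..D} - {g i}. inverse (real (g i) - real b) * (real (h i) - real b)) = 0"
        by (intro prod_zero bexI[of _ "h i"]) auto
      then have "M g (\<lambda>i. real (h i)) = 0"
        unfolding M_def using assms(2) i(1) by (intro prod_zero) auto
      then show ?thesis using False by simp
    qed
    then have "(\<Sum>g\<in>G. c g * M g (\<lambda>i. real (h i))) = (\<Sum>g\<in>G. if g = h then c g else 0)"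
      by (intro sum.cong) auto
    also have "\<dots> = c h" using \<open>finite G\<close> h(1) by simp
    finally show "(\<Sum>g\<in>G. c g * M g (\<lambda>i. real (h i))) \<noteq> 0" using h(2) by simp
  next
    fix u assume "u \<in> {u. \<exists>z. q z \<noteq> 0 \<and> (\<forall>i\<in>I. u i * q z = n i z)}"
    then obtain z where z: "q z \<noteq> 0" "\<And>i. i \<in> I \<Longrightarrow> n i z = u i * q z" by auto
    \<comment> \<open>Each of the \<open>N\<close> indices contributes \<open>D\<close> factors
      \<open>q z\<close>.\<close>
    have "L g z = q z ^ (N * D) * M g u" if "g \<in> G" for g
    proof -
      have "L g z = (\<Prod>i\<in>I. q z ^ D * (\<Prod>b\<in>{..D} - {g i}. inverse (real (g i) - real b) * (u i - real b)))"
        unfolding L_def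
      proof (rule prod.cong[OF refl])
        fix i assume i: "i \<in> I"
        then have "g i \<le> D" using that by (auto simp: G_def)
        then have "card ({..D} - {g i}) = D" by simp
        moreover have "(\<Prod>b\<in>{..D} - {g i}. inverse (real (g i) - real b) * (n i z - real b * q z)) =
          (\<Prod>b\<in>{..D} - {g i}. q z * (inverse (real (g i) - real b) * (u i - real b)))"
          unfolding z(2)[OF i] by (intro prod.cong) (auto simp: algebra_simps)
        ultimately show "(\<Prod>b\<in>{..D} - {g i}. inverse (real (g i) - real b) * (n i z - real b * q z)) =
          q z ^ D * (\<Prod>b\<in>{..D} - {g i}. inverse (real (g i) - real b) * (u i - real b))"
          by (simp only: prod.distrib prod_constant)
      qed
      then show ?thesis
        by (simp only: prod.distrib prod_constant M_def N_def power_mult[symmetric] mult.commute)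
    qed
    then have "(\<Sum>g\<in>G. c g * L g z) = (\<Sum>g\<in>G. q z ^ (N * D) * (c g * M g u))"
      by (intro sum.cong) (auto simp: mult_ac)
    then have "q z ^ (N * D) * (\<Sum>g\<in>G. c g * M g u) = 0"
      using zero[of z] by (simp only: sum_distrib_left)
    then show "(\<Sum>g\<in>G. c g * M g u) = 0" using z(1) by simp
  qed
qed

subsection \<open>Overdetermined parametric linear systems\<close>

text \<open>Induction on the number of equations: each equation is used to eliminate one of the unknowns
  \<open>v\<close>, in terms of which the coordinates of \<open>u\<close> are given. The rows stay independent when pivoting,
  because they are only multiplied by the nonzero pivot and changed by multiples of the pivot row.\<close>

lemma alg_null_linear_system_aux:
  fixes R :: "'r set" and M :: "'m set" and I :: "'i set" and K :: "'k set"
  assumes "finite R" "finite M" "finite I" "finite K" "card M + card K < card I + card R"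
    and "poly_in M q" "\<And>i. poly_in M (n0 i)" "\<And>i k. poly_in M (n i k)"
    and "\<And>r k. poly_in M (A r k)" "\<And>r. poly_in M (b r)"
  shows "alg_null I {u. \<exists>t v. q t \<noteq> 0 \<and>
      (\<forall>y. (\<forall>k\<in>K. (\<Sum>r\<in>R. y r * A r k t) = 0) \<longrightarrow> (\<forall>r\<in>R. y r = 0)) \<and>
      (\<forall>r\<in>R. (\<Sum>k\<in>K. A r k t * v k) = b r t) \<and>
      (\<forall>i\<in>I. u i * q t = n0 i t + (\<Sum>k\<in>K. n i k t * v k))}"
  using assms
proof (induction R arbitrary: K q n0 n A b rule: finite_induct)
  case empty
  \<comment> \<open>With no equations left, parameters (\<open>Inl\<close>) and remaining unknowns
    (\<open>Inr\<close>) are free variables of one rational map.\<close>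
  let ?n = "\<lambda>i z. n0 i (z \<circ> Inl) + (\<Sum>k\<in>K. n i k (z \<circ> Inl) * z (Inr k))"
  have "alg_null I {u. \<exists>z. q (z \<circ> Inl) \<noteq> 0 \<and> (\<forall>i\<in>I. u i * q (z \<circ> Inl) = ?n i z)}"
  proof (rule alg_null_rational_image)
    show "card (M <+> K) < card I" using empty by (simp add: card_Plus)
    show "poly_in (M <+> K) (\<lambda>z. q (z \<circ> Inl))" using empty by (intro poly_in_comp_Inl)
    show "poly_in (M <+> K) (?n i)" for i
      using empty by (intro poly_in_add poly_in_sum poly_in_mult poly_in_comp_Inl poly_in_var) auto
  qed (use empty in auto)
  then show ?case
  proof (rule alg_null_subset, intro subsetI, elim CollectE exE conjE)
    fix u :: "'i \<Rightarrow> real" and t v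
    assume "q t \<noteq> 0" "\<forall>i\<in>I. u i * q t = n0 i t + (\<Sum>k\<in>K. n i k t * v k)"
    then show "u \<in> {u. \<exists>z. q (z \<circ> Inl) \<noteq> 0 \<and> (\<forall>i\<in>I. u i * q (z \<circ> Inl) = ?n i z)}"
      by (intro CollectI exI[of _ "case_sum t v"]) (simp add: case_sum_o_inj)
  qed
next
  case (insert p R)
  \<comment> \<open>The instances with pivot \<open>A p c t\<close>: row \<open>p\<close> is solved
    for \<open>v c\<close> and substituted, everything being multiplied by the pivot so that it
    stays polynomial in \<open>t\<close>.\<close>
  define Z where "Z c = {u. \<exists>t v. q t * A p c t \<noteq> 0 \<and>
      (\<forall>y. (\<forall>k\<in>K - {c}. (\<Sum>r\<in>R. y r * (A p c t * A r k t - A r c t * A p k t)) = 0) \<longrightarrow>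
         (\<forall>r\<in>R. y r = 0)) \<and>
      (\<forall>r\<in>R. (\<Sum>k\<in>K - {c}. (A p c t * A r k t - A r c t * A p k t) * v k) =
         A p c t * b r t - A r c t * b p t) \<and>
      (\<forall>i\<in>I. u i * (q t * A p c t) = A p c t * n0 i t + n i c t * b p t +
         (\<Sum>k\<in>K - {c}. (A p c t * n i k t - n i c t * A p k t) * v k))}" for c
  have "alg_null I (Z c)" if c: "c \<in> K" for c
    unfolding Z_def
  proof (rule insert.IH)
    have "card K > 0" using c insert.prems by (auto simp: card_gt_0_iff)
    then show "card M + card (K - {c}) < card I + card R"
      using insert.prems(4) insert.hyps c by simp
  qed (use insert.prems in \<open>auto intro!: poly_in_add poly_in_mult poly_in_diff\<close>)
  then have "alg_null I (\<Union>c\<in>K. Z c)"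
    using insert.prems by (intro alg_null_UN)
  then show ?case
  proof (rule alg_null_subset, intro subsetI, elim CollectE exE conjE)
    fix u t v
    assume q: "q t \<noteq> 0"
      and ind: "\<forall>y. (\<forall>k\<in>K. (\<Sum>r\<in>insert p R. y r * A r k t) = 0) \<longrightarrow> (\<forall>r\<in>insert p R. y r = 0)"
      and row: "\<forall>r\<in>insert p R. (\<Sum>k\<in>K. A r k t * v k) = b r t"
      and u: "\<forall>i\<in>I. u i * q t = n0 i t + (\<Sum>k\<in>K. n i k t * v k)"
    have sumR: "(\<Sum>r\<in>insert p R. f r) = f p + (\<Sum>r\<in>R. f r)" for f :: "_ \<Rightarrow> real"
      using insert.hyps by simp
    \<comment> \<open>If row \<open>p\<close> were zero, the unit vector at \<open>p\<close> would
      be a nontrivial relation.\<close>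
    have "\<exists>c\<in>K. A p c t \<noteq> 0"
    proof (rule ccontr)
      assume *: "\<not> ?thesis"
      have "(\<Sum>r\<in>insert p R. (if r = p then 1 else 0) * A r k t) = 0" if "k \<in> K" for k
        using that * insert.hyps by (auto intro!: sum.neutral)
      with ind[rule_format, of "\<lambda>r. if r = p then 1 else 0" p] show False by simp
    qed
    then obtain c where c: "c \<in> K" "A p c t \<noteq> 0" by blast
    let ?a = "A p c t"
    have sumK: "(\<Sum>k\<in>K. f k) = f c + (\<Sum>k\<in>K - {c}. f k)" for f :: "_ \<Rightarrow> real"
      using c(1) insert.prems by (intro sum.remove) auto
    have vc: "?a * v c = b p t - (\<Sum>k\<in>K - {c}. A p k t * v k)"
      using row sumK[of "\<lambda>k. A p k t * v k"] by simp
    have elim: "(\<Sum>k\<in>K - {c}. (?a * f k - f c * A p k t) * v k) =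
        ?a * (\<Sum>k\<in>K. f k * v k) - f c * b p t" for f
    proof -
      have "(\<Sum>k\<in>K - {c}. (?a * f k - f c * A p k t) * v k) =
          ?a * (\<Sum>k\<in>K - {c}. f k * v k) - f c * (\<Sum>k\<in>K - {c}. A p k t * v k)"
        by (simp add: sum_distrib_left sum_subtractf algebra_simps)
      also have "(\<Sum>k\<in>K - {c}. A p k t * v k) = b p t - ?a * v c" using vc by simp
      finally show ?thesis by (simp add: sumK algebra_simps)
    qed
    have "u \<in> Z c"
      unfolding Z_def
    proof (intro CollectI exI[of _ t] exI[of _ v] conjI allI impI ballI)
      show "q t * ?a \<noteq> 0" using q c by simp
    next
      fix r assume "r \<in> R"
      then show "(\<Sum>k\<in>K - {c}. (?a * A r k t - A r c t * A p k t) * v k) = ?a * b r t - A r c t * b p t"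
        using row elim[of "\<lambda>k. A r k t"] by simp
    next
      fix i assume "i \<in> I"
      then have "?a * (u i * q t) = ?a * (n0 i t + (\<Sum>k\<in>K. n i k t * v k))"
        using u by simp
      then have "u i * (q t * ?a) = ?a * n0 i t + ?a * (\<Sum>k\<in>K. n i k t * v k)"
        by (simp only: distrib_left mult_ac)
      then show "u i * (q t * ?a) = ?a * n0 i t + n i c t * b p t +
         (\<Sum>k\<in>K - {c}. (?a * n i k t - n i c t * A p k t) * v k)"
        by (simp only: elim[of "\<lambda>k. n i k t"])
    next
      fix y r
      assume y: "\<forall>k\<in>K - {c}. (\<Sum>r\<in>R. y r * (?a * A r k t - A r c t * A p k t)) = 0" and r: "r \<in> R"
      \<comment> \<open>A relation \<open>y\<close> among the reduced rows lifts to a relation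
        \<open>y'\<close> among the original ones; the coefficient \<open>- s\<close> of row
        \<open>p\<close> makes column \<open>c\<close> cancel.\<close>
      define s where "s = (\<Sum>r\<in>R. y r * A r c t)"
      define y' where "y' r = (if r = p then - s else ?a * y r)" for r
      have "(\<Sum>r\<in>insert p R. y' r * A r k t) = (\<Sum>r\<in>R. y r * (?a * A r k t - A r c t * A p k t))" for k
      proof -
        have "(\<Sum>r\<in>R. y' r * A r k t) = (\<Sum>r\<in>R. ?a * y r * A r k t)"
          using insert.hyps by (intro sum.cong) (auto simp: y'_def)
        then have "(\<Sum>r\<in>insert p R. y' r * A r k t) = - s * A p k t + (\<Sum>r\<in>R. ?a * y r * A r k t)"
          unfolding sumR by (simp add: y'_def)
        also have "\<dots> = (\<Sum>r\<in>R. y r * (?a * A r k t - A r c t * A p k t))"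
          by (simp add: s_def sum_distrib_left sum_distrib_right sum_subtractf sum_negf algebra_simps)
        finally show ?thesis .
      qed
      moreover have "(\<Sum>r\<in>R. y r * (?a * A r c t - A r c t * A p c t)) = 0"
        by (simp add: algebra_simps)
      ultimately have "\<forall>k\<in>K. (\<Sum>r\<in>insert p R. y' r * A r k t) = 0" using y by auto
      then have "y' r = 0" using ind r by blast
      then show "y r = 0" using insert.hyps r c by (auto simp: y'_def split: if_splits)
    qed
    then show "u \<in> (\<Union>c\<in>K. Z c)" using c(1) by blast
  qed
qed

text \<open>The elimination starts with the entries of \<open>u\<close> themselves as unknowns and
  denominator 1, so \<open>card I\<close> cancels in the count.\<close>

lemma alg_null_linear_system:
  assumes "finite R" "finite M" "finite I" "card M < card R"
    and "\<And>r k. poly_in M (A r k)" "\<And>r. poly_in M (b r)"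
  shows "alg_null I {u. \<exists>t.
      (\<forall>y. (\<forall>k\<in>I. (\<Sum>r\<in>R. y r * A r k t) = 0) \<longrightarrow> (\<forall>r\<in>R. y r = 0)) \<and>
      (\<forall>r\<in>R. (\<Sum>k\<in>I. A r k t * u k) = b r t)}"
proof -
  have "alg_null I {u. \<exists>t v. (\<lambda>_. 1) t \<noteq> (0::real) \<and>
      (\<forall>y. (\<forall>k\<in>I. (\<Sum>r\<in>R. y r * A r k t) = 0) \<longrightarrow> (\<forall>r\<in>R. y r = 0)) \<and>
      (\<forall>r\<in>R. (\<Sum>k\<in>I. A r k t * v k) = b r t) \<and>
      (\<forall>i\<in>I. u i * (\<lambda>_. 1) t = (\<lambda>i t. 0) i t + (\<Sum>k\<in>I. (\<lambda>i k t. if i = k then 1 else 0) i k t * v k))}"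
    using assms by (intro alg_null_linear_system_aux) auto
  then show ?thesis
  proof (rule alg_null_subset, intro subsetI, elim CollectE exE conjE)
    fix u t
    assume *: "\<forall>y. (\<forall>k\<in>I. (\<Sum>r\<in>R. y r * A r k t) = 0) \<longrightarrow> (\<forall>r\<in>R. y r = 0)"
      "\<forall>r\<in>R. (\<Sum>k\<in>I. A r k t * u k) = b r t"
    have "u i = (\<Sum>k\<in>I. (if i = k then 1 else 0) * u k)" if "i \<in> I" for i
      using that assms(3) by (simp add: if_distrib[of "\<lambda>x. x * _"] cong: if_cong)
    with * show "u \<in> {u. \<exists>t v. (\<lambda>_. 1) t \<noteq> (0::real) \<and>
      (\<forall>y. (\<forall>k\<in>I. (\<Sum>r\<in>R. y r * A r k t) = 0) \<longrightarrow> (\<forall>r\<in>R. y r = 0)) \<and>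
      (\<forall>r\<in>R. (\<Sum>k\<in>I. A r k t * v k) = b r t) \<and>
      (\<forall>i\<in>I. u i * (\<lambda>_. 1) t = (\<lambda>i t. 0) i t + (\<Sum>k\<in>I. (\<lambda>i k t. if i = k then 1 else 0) i k t * v k))}"
      by (intro CollectI exI[of _ t] exI[of _ u]) simp
  qed
qed

section \<open>Monomials and their partial derivatives\<close>

definition monomial_at :: "('n::finite \<Rightarrow> nat) \<Rightarrow> real ^ 'n \<Rightarrow> real" where
  "monomial_at \<alpha> x = (\<Prod>j\<in>UNIV. (x $ j) ^ \<alpha> j)"

text \<open>For \<open>\<alpha> l = 0\<close> the truncated exponent does no harm, because the
  factor \<open>real (\<alpha> l)\<close> vanishes.\<close>

definition dmonomial_at :: "('n::finite \<Rightarrow> nat) \<Rightarrow> 'n \<Rightarrow> real ^ 'n \<Rightarrow> real" where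
  "dmonomial_at \<alpha> l x = real (\<alpha> l) * (x $ l) ^ (\<alpha> l - 1) * (\<Prod>j\<in>UNIV - {l}. (x $ j) ^ \<alpha> j)"

definition poly_gradient ::
    "nat \<Rightarrow> (nat \<times> ('n::finite \<Rightarrow> nat) \<Rightarrow> real) \<Rightarrow> nat \<Rightarrow> real ^ 'n \<Rightarrow> real ^ 'n" where
  "poly_gradient d u i x = (\<chi> l. \<Sum>\<alpha>\<in>multi_indices d. u (i, \<alpha>) * dmonomial_at \<alpha> l x)"

definition unit_index :: "'n \<Rightarrow> 'n \<Rightarrow> nat" where
  "unit_index l j = (if j = l then 1 else 0)"

lemma finite_multi_indices: "finite (multi_indices d :: ('n::finite \<Rightarrow> nat) set)"
proof (rule finite_subset)
  show "(multi_indices d :: ('n \<Rightarrow> nat) set) \<subseteq> UNIV \<rightarrow>\<^sub>E {..d}"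
    unfolding multi_indices_def
  proof (intro subsetI PiE_I)
    fix \<alpha> :: "'n \<Rightarrow> nat" and j
    assume "\<alpha> \<in> {\<alpha>. (\<Sum>j\<in>UNIV. \<alpha> j) \<le> d}"
    moreover have "\<alpha> j \<le> (\<Sum>j\<in>UNIV. \<alpha> j)" by (rule member_le_sum) auto
    ultimately show "\<alpha> j \<in> {..d}" by simp
  qed simp
qed (simp add: finite_PiE)

lemma finite_coeff_indices: "finite (coeff_indices d r)"
  unfolding coeff_indices_def by (simp add: finite_multi_indices)

lemma poly_family_eq: "poly_family d u i x = (\<Sum>\<alpha>\<in>multi_indices d. u (i, \<alpha>) * monomial_at \<alpha> x)"
  unfolding poly_family_def monomial_at_def ..

lemma has_derivative_monomial_at:
  "(monomial_at \<alpha> has_derivative (\<lambda>v. \<Sum>l\<in>UNIV. v $ l * dmonomial_at \<alpha> l x)) (at x)"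
proof -
  have "((\<lambda>x. \<Prod>j\<in>UNIV. (x $ j) ^ \<alpha> j) has_derivative
      (\<lambda>v. \<Sum>l\<in>UNIV. (of_nat (\<alpha> l) * v $ l * (x $ l) ^ (\<alpha> l - 1)) * (\<Prod>j\<in>UNIV - {l}. (x $ j) ^ \<alpha> j))) (at x)"
    by (intro has_derivative_prod has_derivative_power bounded_linear_imp_has_derivative
        bounded_linear_vec_nth)
  then show ?thesis
    unfolding monomial_at_def dmonomial_at_def by (simp add: mult_ac)
qed

lemma has_derivative_poly_family:
  "(poly_family d u i has_derivative (\<lambda>v. v \<bullet> poly_gradient d u i x)) (at x)"
proof -
  have "((\<lambda>x. \<Sum>\<alpha>\<in>multi_indices d. u (i, \<alpha>) * monomial_at \<alpha> x) has_derivative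
      (\<lambda>v. \<Sum>\<alpha>\<in>multi_indices d. u (i, \<alpha>) * (\<Sum>l\<in>UNIV. v $ l * dmonomial_at \<alpha> l x))) (at x)"
    by (intro has_derivative_sum has_derivative_mult_right has_derivative_monomial_at)
  moreover have "(\<Sum>\<alpha>\<in>multi_indices d. u (i, \<alpha>) * (\<Sum>l\<in>UNIV. v $ l * dmonomial_at \<alpha> l x)) =
      v \<bullet> poly_gradient d u i x" for v
    unfolding poly_gradient_def inner_vec_def
    by (simp add: sum_distrib_left mult_ac) (rule sum.swap)
  moreover have "poly_family d u i = (\<lambda>x. \<Sum>\<alpha>\<in>multi_indices d. u (i, \<alpha>) * monomial_at \<alpha> x)"
    by (simp add: fun_eq_iff poly_family_eq)
  ultimately show ?thesis by simp
qed

lemma continuous_on_poly_gradient: "continuous_on S (poly_gradient d u i)"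
  unfolding poly_gradient_def dmonomial_at_def
  by (intro continuous_intros)

lemma monomial_at_add: "monomial_at (\<lambda>j. \<alpha> j + \<beta> j) x = monomial_at \<alpha> x * monomial_at \<beta> x"
  unfolding monomial_at_def by (simp add: power_add prod.distrib)

lemma prod_unit_index:
  assumes "finite S"
  shows "(\<Prod>j\<in>S. (x $ j) ^ unit_index l j) = (if l \<in> S then x $ l else (1::real))"
proof -
  have "(\<Prod>j\<in>S. (x $ j) ^ unit_index l j) = (\<Prod>j\<in>S. if j = l then x $ j else 1)"
    by (intro prod.cong) (auto simp: unit_index_def)
  then show ?thesis using assms by simp
qed

lemma monomial_at_unit_index: "monomial_at (unit_index l) x = x $ l"
  unfolding monomial_at_def by (simp add: prod_unit_index)

lemma monomial_at_0: "monomial_at (\<lambda>_. 0) x = 1"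
  unfolding monomial_at_def by simp

lemma dmonomial_at_0: "dmonomial_at (\<lambda>_. 0) l x = 0"
  unfolding dmonomial_at_def by simp

lemma dmonomial_at_unit_index: "dmonomial_at (unit_index m) l x = (if l = m then 1 else 0)"
proof (cases "l = m")
  case True
  then show ?thesis
    unfolding dmonomial_at_def prod_unit_index[OF finite_Diff[OF finite]]
    by (simp add: unit_index_def)
qed (simp add: dmonomial_at_def unit_index_def)

text \<open>Product rule for one more variable. Repeated use evaluates the quadratic and cubic test
  monomials, written as sums of unit indices.\<close>

lemma dmonomial_at_add_unit_index:
  "dmonomial_at (\<lambda>j. \<alpha> j + unit_index m j) l x =
     dmonomial_at \<alpha> l x * x $ m + (if l = m then monomial_at \<alpha> x else 0)"
proof (cases "l = m")
  case True
  have "monomial_at \<alpha> x = (x $ l) ^ \<alpha> l * (\<Prod>j\<in>UNIV - {l}. (x $ j) ^ \<alpha> j)"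
    unfolding monomial_at_def by (rule prod.remove) auto
  then show ?thesis
    using True prod_unit_index[of "UNIV - {l}" x l]
    by (cases "\<alpha> l")
       (simp_all add: dmonomial_at_def unit_index_def power_add prod.distrib algebra_simps)
next
  case False
  then show ?thesis
    by (simp add: dmonomial_at_def power_add prod.distrib prod_unit_index)
       (simp add: unit_index_def)
qed

lemma sum_unit_index: "(\<Sum>j\<in>UNIV. unit_index l j) = (1::nat)" for l :: "'n::finite"
  unfolding unit_index_def by simp

text \<open>A relation among the rows, read in the columns \<open>(i, \<alpha>)\<close> for one
  fixed \<open>i\<close>, says that such a combination of values and partial derivatives at
  \<open>x\<close> and \<open>y\<close> annihilates all monomials of degree at most
  \<open>d\<close>.\<close>

definition two_point_functional ::
    "real \<Rightarrow> real \<Rightarrow> ('n::finite \<Rightarrow> real) \<Rightarrow> ('n \<Rightarrow> real) \<Rightarrow> real ^ 'n \<Rightarrow> real ^ 'n \<Rightarrow> ('n \<Rightarrow> nat) \<Rightarrow> real" where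
  "two_point_functional a b p q x y \<alpha> =
     a * monomial_at \<alpha> x + b * monomial_at \<alpha> y +
     (\<Sum>l\<in>UNIV. p l * dmonomial_at \<alpha> l x) + (\<Sum>l\<in>UNIV. q l * dmonomial_at \<alpha> l y)"

context
  fixes d :: nat and a b :: real and p q :: "'n::finite \<Rightarrow> real" and x y :: "real ^ 'n"
  assumes zero: "\<And>\<alpha>. \<alpha> \<in> multi_indices d \<Longrightarrow> two_point_functional a b p q x y \<alpha> = 0"
begin

lemma two_point_degree_0: "a + b = 0"
  using zero[of "\<lambda>_. 0"]
  by (simp add: multi_indices_def two_point_functional_def monomial_at_0 dmonomial_at_0)

lemma two_point_degree_1:
  assumes "d \<ge> 1"
  shows "p l + q l = - b * (y $ l - x $ l)"
proof -
  have "a * x $ l + b * y $ l + p l + q l = 0"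
    using zero[of "unit_index l"] assms
    by (simp add: multi_indices_def sum_unit_index two_point_functional_def
        monomial_at_unit_index dmonomial_at_unit_index if_distrib cong: if_cong)
  then show ?thesis using two_point_degree_0 by algebra
qed

text \<open>Only multiples of the trapezoidal rule annihilate all quadratics, and \<open>b\<close>
  is the multiple.\<close>

lemma two_point_degree_2:
  assumes "d \<ge> 2" "y $ k \<noteq> x $ k"
  shows "p l = - b / 2 * (y $ l - x $ l)" "q l = - b / 2 * (y $ l - x $ l)"
proof -
  \<comment> \<open>This is the functional applied to the product of the linear forms z_l - x_l and
    z_m - x_m, whose value and gradient at \<open>x\<close> are zero.\<close>
  have eq: "b * (y $ l - x $ l) * (y $ m - x $ m) + q l * (y $ m - x $ m) + q m * (y $ l - x $ l) = 0"
    for l m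
  proof -
    have "two_point_functional a b p q x y (\<lambda>j. unit_index l j + unit_index m j) = 0"
      using assms by (intro zero) (simp add: multi_indices_def sum.distrib sum_unit_index)
    then have "a * (x $ l * x $ m) + b * (y $ l * y $ m) +
        (p l * x $ m + p m * x $ l) + (q l * y $ m + q m * y $ l) = 0"
      by (simp add: two_point_functional_def dmonomial_at_add_unit_index monomial_at_add
          monomial_at_unit_index dmonomial_at_unit_index distrib_left sum.distrib
          if_distrib[of "\<lambda>x. _ * x"] if_distrib[of "\<lambda>x. x * _"] cong: if_cong)
    moreover have "a = - b" using two_point_degree_0 by simp
    moreover have "p l = - b * (y $ l - x $ l) - q l" "p m = - b * (y $ m - x $ m) - q m"
      using two_point_degree_1[of l] two_point_degree_1[of m] assms(1) by simp_all
    ultimately show ?thesis by algebra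
  qed
  have "(b * (y $ k - x $ k) + 2 * q k) * (y $ k - x $ k) = 0"
    using eq[of k k] by algebra
  then have "2 * q k = - b * (y $ k - x $ k)" using assms(2) by simp
  then have "(2 * q l + b * (y $ l - x $ l)) * (y $ k - x $ k) = 0"
    using eq[of l k] by algebra
  then show "q l = - b / 2 * (y $ l - x $ l)" using assms(2) by simp
  then show "p l = - b / 2 * (y $ l - x $ l)"
    using two_point_degree_1[of l] assms(1) by simp
qed

text \<open>On the cube of the coordinate \<open>k\<close> the error of the trapezoidal rule is a
  nonzero multiple of \<open>(y $ k - x $ k) ^ 3\<close>.\<close>

lemma two_point_degree_3:
  assumes "d \<ge> 3" "y $ k \<noteq> x $ k"
  shows "a = 0" "b = 0" "p l = 0" "q l = 0"
proof -
  have "two_point_functional a b p q x y (\<lambda>j. unit_index k j + unit_index k j + unit_index k j) = 0"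
    using assms by (intro zero) (simp add: multi_indices_def sum.distrib sum_unit_index)
  then have "a * (x $ k * x $ k * x $ k) + b * (y $ k * y $ k * y $ k) +
      3 * p k * (x $ k * x $ k) + 3 * q k * (y $ k * y $ k) = 0"
    by (simp add: two_point_functional_def dmonomial_at_add_unit_index monomial_at_add
        monomial_at_unit_index dmonomial_at_unit_index distrib_left distrib_right sum.distrib
        if_distrib[of "\<lambda>x. _ * x"] if_distrib[of "\<lambda>x. x * _"] cong: if_cong)
  moreover have "a = - b" using two_point_degree_0 by simp
  moreover have "2 * p k = - b * (y $ k - x $ k)" "2 * q k = - b * (y $ k - x $ k)"
    using two_point_degree_2[OF _ assms(2), of k] assms(1) by simp_all
  ultimately have "b * (y $ k - x $ k) ^ 3 = 0" by algebra
  then show b: "b = 0" using assms(2) by simp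
  show "a = 0" using b two_point_degree_0 by simp
  show "p l = 0" "q l = 0"
    using two_point_degree_2[OF _ assms(2), of l] assms(1) b by simp_all
qed

end

section \<open>Affine and quadratic polynomials\<close>

lemma multi_indices_SucE:
  fixes \<alpha> :: "'n::finite \<Rightarrow> nat"
  assumes "\<alpha> \<in> multi_indices (Suc d)"
  obtains "\<alpha> = (\<lambda>_. 0)" | \<beta> m where "\<beta> \<in> multi_indices d" "\<alpha> = (\<lambda>j. \<beta> j + unit_index m j)"
proof (cases "\<alpha> = (\<lambda>_. 0)")
  case False
  then obtain m where m: "\<alpha> m \<noteq> 0" by auto
  define \<beta> where "\<beta> = \<alpha>(m := \<alpha> m - 1)"
  have \<alpha>: "\<alpha> = (\<lambda>j. \<beta> j + unit_index m j)"
    using m by (auto simp: \<beta>_def unit_index_def)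
  then have "(\<Sum>j\<in>UNIV. \<alpha> j) = (\<Sum>j\<in>UNIV. \<beta> j + unit_index m j)"
    by (rule arg_cong)
  then have "(\<Sum>j\<in>UNIV. \<alpha> j) = (\<Sum>j\<in>UNIV. \<beta> j) + 1"
    by (simp add: sum.distrib sum_unit_index)
  then have "\<beta> \<in> multi_indices d" using assms by (simp add: multi_indices_def)
  then show ?thesis using \<alpha> that(2) by blast
qed (use that in blast)

lemma multi_indices_0: "\<alpha> \<in> multi_indices 0 \<Longrightarrow> \<alpha> = (\<lambda>_. 0)"
  by (auto simp: multi_indices_def)

lemma multi_indices_1E:
  assumes "\<alpha> \<in> multi_indices 1"
  obtains "\<alpha> = (\<lambda>_. 0)" | m where "\<alpha> = unit_index m"
  using assms unfolding One_nat_def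
proof (cases rule: multi_indices_SucE)
  case (2 \<beta> m)
  then have "\<alpha> = unit_index m" using multi_indices_0 by fastforce
  then show ?thesis using that(2) by blast
qed (use that in blast)

lemma poly_gradient_degree_1: "poly_gradient 1 u i x = poly_gradient 1 u i 0"
proof -
  have "dmonomial_at \<alpha> l x = dmonomial_at \<alpha> l 0" if "\<alpha> \<in> multi_indices 1" for \<alpha> :: "'a \<Rightarrow> nat" and l
    using that by (cases rule: multi_indices_1E) (simp_all add: dmonomial_at_0 dmonomial_at_unit_index)
  then show ?thesis unfolding poly_gradient_def by (simp add: vec_eq_iff)
qed

lemma poly_family_degree_1:
  "poly_family 1 u i x = poly_family 1 u i 0 + x \<bullet> poly_gradient 1 u i 0"
proof -
  have "monomial_at \<alpha> x = monomial_at \<alpha> 0 + (\<Sum>l\<in>UNIV. x $ l * dmonomial_at \<alpha> l 0)"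
    if "\<alpha> \<in> multi_indices 1" for \<alpha> :: "'a \<Rightarrow> nat"
    using that
    by (cases rule: multi_indices_1E)
       (simp_all add: monomial_at_0 monomial_at_unit_index dmonomial_at_0 dmonomial_at_unit_index
         if_distrib cong: if_cong)
  then have "poly_family 1 u i x = (\<Sum>\<alpha>\<in>multi_indices 1. u (i, \<alpha>) * monomial_at \<alpha> 0 +
      (\<Sum>l\<in>UNIV. x $ l * (u (i, \<alpha>) * dmonomial_at \<alpha> l 0)))"
    unfolding poly_family_eq by (simp add: distrib_left sum_distrib_left mult_ac)
  also have "\<dots> = poly_family 1 u i 0 + x \<bullet> poly_gradient 1 u i 0"
    unfolding poly_family_eq sum.distrib poly_gradient_def inner_vec_def
    by (subst sum.swap) (simp add: sum_distrib_left)
  finally show ?thesis .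
qed

text \<open>Partial derivatives of quadratics are affine and so respect affine combinations of
  points. This produces the line of critical points.\<close>

lemma poly_gradient_degree_2:
  "poly_gradient 2 u i (x + s *\<^sub>R (y - x)) $ l =
     (1 - s) * poly_gradient 2 u i x $ l + s * poly_gradient 2 u i y $ l"
proof -
  have mono: "monomial_at \<beta> (x + s *\<^sub>R (y - x)) = (1 - s) * monomial_at \<beta> x + s * monomial_at \<beta> y"
    if "\<beta> \<in> multi_indices 1" for \<beta> :: "'a \<Rightarrow> nat"
    using that
    by (cases rule: multi_indices_1E) (simp_all add: monomial_at_0 monomial_at_unit_index algebra_simps)
  have "dmonomial_at \<alpha> l (x + s *\<^sub>R (y - x)) = (1 - s) * dmonomial_at \<alpha> l x + s * dmonomial_at \<alpha> l y"
    if "\<alpha> \<in> multi_indices 2" for \<alpha> :: "'a \<Rightarrow> nat"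
    using that unfolding numeral_2_eq_2
  proof (cases rule: multi_indices_SucE)
    case (2 \<beta> m)
    then have \<beta>: "\<beta> \<in> multi_indices 1" by simp
    then have "\<exists>c. \<forall>z. dmonomial_at \<beta> l z = c"
      by (cases rule: multi_indices_1E) (simp_all add: dmonomial_at_0 dmonomial_at_unit_index)
    then obtain c where "\<And>z. dmonomial_at \<beta> l z = c" by blast
    then show ?thesis
      unfolding 2 dmonomial_at_add_unit_index mono[OF \<beta>] by (simp add: algebra_simps)
  qed (simp add: dmonomial_at_0)
  then have "(\<Sum>\<alpha>\<in>multi_indices 2. u (i, \<alpha>) * dmonomial_at \<alpha> l (x + s *\<^sub>R (y - x))) =
      (\<Sum>\<alpha>\<in>multi_indices 2. (1 - s) * (u (i, \<alpha>) * dmonomial_at \<alpha> l x) +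
         s * (u (i, \<alpha>) * dmonomial_at \<alpha> l y))"
    by (intro sum.cong) (simp_all add: distrib_left mult_ac)
  then show ?thesis
    unfolding poly_gradient_def by (simp add: sum_distrib_left sum.distrib)
qed

section \<open>Coefficient tuples with prescribed data at two points\<close>

text \<open>The conditions imposed on the polynomials at the points \<open>x\<close> and \<open>y\<close>, with weights \<open>L\<close> at \<open>x\<close>
  and \<open>L'\<close> at \<open>y\<close>: \<open>Val\<close> and \<open>Val2\<close> prescribe values of single polynomials, \<open>Dif\<close> requires equal
  values at \<open>x\<close> and \<open>y\<close>, \<open>Grad\<close> and \<open>Grad2\<close> let a partial derivative of the weighted sum vanish,
  \<open>Wval\<close> and \<open>Wval2\<close> prescribe the value of the weighted sum.\<close>

datatype 'n row = Val nat | Val2 nat | Dif nat | Grad 'n | Grad2 'n | Wval | Wval2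

definition all_rows :: "nat \<Rightarrow> 'n row set" where
  "all_rows r = Val ` {1..r} \<union> (Val2 ` {1..r} \<union> (Dif ` {1..r} \<union>
     (range Grad \<union> (range Grad2 \<union> {Wval, Wval2}))))"

fun row_coeff :: "real ^ 'n \<Rightarrow> real ^ 'n \<Rightarrow> (nat \<Rightarrow> real) \<Rightarrow> (nat \<Rightarrow> real) \<Rightarrow>
    'n::finite row \<Rightarrow> nat \<times> ('n \<Rightarrow> nat) \<Rightarrow> real" where
  "row_coeff x y L L' (Val k) (i, \<alpha>) = (if i = k then monomial_at \<alpha> x else 0)"
| "row_coeff x y L L' (Val2 k) (i, \<alpha>) = (if i = k then monomial_at \<alpha> y else 0)"
| "row_coeff x y L L' (Dif k) (i, \<alpha>) = (if i = k then monomial_at \<alpha> y - monomial_at \<alpha> x else 0)"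
| "row_coeff x y L L' (Grad l) (i, \<alpha>) = L i * dmonomial_at \<alpha> l x"
| "row_coeff x y L L' (Grad2 l) (i, \<alpha>) = L' i * dmonomial_at \<alpha> l y"
| "row_coeff x y L L' Wval (i, \<alpha>) = L i * monomial_at \<alpha> x"
| "row_coeff x y L L' Wval2 (i, \<alpha>) = L' i * monomial_at \<alpha> y"

fun row_value :: "nat \<Rightarrow> nat \<Rightarrow> (nat \<times> ('n::finite \<Rightarrow> nat) \<Rightarrow> real) \<Rightarrow> real ^ 'n \<Rightarrow> real ^ 'n \<Rightarrow>
    (nat \<Rightarrow> real) \<Rightarrow> (nat \<Rightarrow> real) \<Rightarrow> 'n row \<Rightarrow> real" where
  "row_value d r u x y L L' (Val k) = poly_family d u k x"
| "row_value d r u x y L L' (Val2 k) = poly_family d u k y"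
| "row_value d r u x y L L' (Dif k) = poly_family d u k y - poly_family d u k x"
| "row_value d r u x y L L' (Grad l) = (\<Sum>i\<in>{1..r}. L i * poly_gradient d u i x $ l)"
| "row_value d r u x y L L' (Grad2 l) = (\<Sum>i\<in>{1..r}. L' i * poly_gradient d u i y $ l)"
| "row_value d r u x y L L' Wval = (\<Sum>i\<in>{1..r}. L i * poly_family d u i x)"
| "row_value d r u x y L L' Wval2 = (\<Sum>i\<in>{1..r}. L' i * poly_family d u i y)"

text \<open>Weights are normalised at one entry and not by their sum, hence the sums in the last two
  equations.\<close>

fun row_rhs :: "nat \<Rightarrow> real \<Rightarrow> (nat \<Rightarrow> real) \<Rightarrow> (nat \<Rightarrow> real) \<Rightarrow> 'n row \<Rightarrow> real" where
  "row_rhs r c L L' (Val k) = c"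
| "row_rhs r c L L' (Val2 k) = c"
| "row_rhs r c L L' (Dif k) = 0"
| "row_rhs r c L L' (Grad l) = 0"
| "row_rhs r c L L' (Grad2 l) = 0"
| "row_rhs r c L L' Wval = c * (\<Sum>i\<in>{1..r}. L i)"
| "row_rhs r c L L' Wval2 = c * (\<Sum>i\<in>{1..r}. L' i)"

lemma finite_all_rows: "finite (all_rows r :: 'n::finite row set)"
  unfolding all_rows_def by simp

lemma sum_all_rows:
  fixes f :: "'n::finite row \<Rightarrow> real"
  shows "(\<Sum>\<rho>\<in>all_rows r. f \<rho>) = (\<Sum>k\<in>{1..r}. f (Val k)) + ((\<Sum>k\<in>{1..r}. f (Val2 k)) +
    ((\<Sum>k\<in>{1..r}. f (Dif k)) + ((\<Sum>l\<in>UNIV. f (Grad l)) + ((\<Sum>l\<in>UNIV. f (Grad2 l)) +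
     (f Wval + f Wval2)))))"
proof -
  have inj: "inj_on Val A" "inj_on Val2 A" "inj_on Dif A" "inj_on Grad B" "inj_on Grad2 B" for A B
    by (auto intro: inj_onI)
  have "(\<Sum>\<rho>\<in>all_rows r. f \<rho>) = sum f (Val ` {1..r}) + (sum f (Val2 ` {1..r}) +
    (sum f (Dif ` {1..r}) + (sum f (range Grad) + (sum f (range Grad2) + sum f {Wval, Wval2}))))"
    unfolding all_rows_def
    by (subst sum.union_disjoint; (force | simp only: add_left_cancel))+
  then show ?thesis by (simp add: sum.reindex inj)
qed

lemma row_value_eq:
  fixes x y :: "real ^ 'n::finite"
  assumes "\<rho> \<in> all_rows r"
  shows "(\<Sum>k\<in>coeff_indices d r. row_coeff x y L L' \<rho> k * u k) = row_value d r u x y L L' \<rho>"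
proof -
  have split: "(\<Sum>k\<in>coeff_indices d r. row_coeff x y L L' \<rho> k * u k) =
      (\<Sum>i\<in>{1..r}. \<Sum>\<alpha>\<in>multi_indices d. row_coeff x y L L' \<rho> (i, \<alpha>) * u (i, \<alpha>))"
    for \<rho> :: "'n row"
    unfolding coeff_indices_def sum.cartesian_product by (simp add: case_prod_unfold)
  have delta: "(\<Sum>i\<in>{1..r}. \<Sum>\<alpha>\<in>multi_indices d. (if i = k then f \<alpha> else 0) * u (i, \<alpha>)) =
      (\<Sum>\<alpha>\<in>multi_indices d. f \<alpha> * u (k, \<alpha>))" if "k \<in> {1..r}" for k and f :: "('n \<Rightarrow> nat) \<Rightarrow> real"
  proof -
    have "(\<Sum>i\<in>{1..r}. \<Sum>\<alpha>\<in>multi_indices d. (if i = k then f \<alpha> else 0) * u (i, \<alpha>)) =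
       (\<Sum>i\<in>{1..r}. if i = k then \<Sum>\<alpha>\<in>multi_indices d. f \<alpha> * u (i, \<alpha>) else 0)"
      by (intro sum.cong) auto
    then show ?thesis using that by simp
  qed
  show ?thesis
  proof (cases \<rho>)
    case (Val k)
    then have k: "k \<in> {1..r}" using assms by (auto simp: all_rows_def)
    show ?thesis
      unfolding split unfolding Val row_coeff.simps delta[OF k] by (simp add: poly_family_eq mult_ac)
  next
    case (Val2 k)
    then have k: "k \<in> {1..r}" using assms by (auto simp: all_rows_def)
    show ?thesis
      unfolding split unfolding Val2 row_coeff.simps delta[OF k] by (simp add: poly_family_eq mult_ac)
  next
    case (Dif k)
    then have k: "k \<in> {1..r}" using assms by (auto simp: all_rows_def)
    show ?thesis
      unfolding split unfolding Dif row_coeff.simps delta[OF k]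
      by (simp add: poly_family_eq sum_subtractf algebra_simps)
  qed (unfold split, simp_all add: poly_family_eq poly_gradient_def sum_distrib_left mult_ac)
qed

lemma poly_in_row_coeff:
  fixes x y :: "('m \<Rightarrow> real) \<Rightarrow> real ^ 'n::finite"
  assumes "\<And>j. poly_in M (\<lambda>t. x t $ j)" "\<And>j. poly_in M (\<lambda>t. y t $ j)"
    and "\<And>i. poly_in M (\<lambda>t. L t i)" "\<And>i. poly_in M (\<lambda>t. L' t i)"
  shows "poly_in M (\<lambda>t. row_coeff (x t) (y t) (L t) (L' t) \<rho> k)"
proof -
  obtain i \<alpha> where k: "k = (i, \<alpha>)" by fastforce
  have m: "poly_in M (\<lambda>t. monomial_at \<alpha> (x t))" "poly_in M (\<lambda>t. monomial_at \<alpha> (y t))"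
    unfolding monomial_at_def by (intro poly_in_prod poly_in_power assms)+
  have if_zero: "poly_in M (\<lambda>t. if b then f t else 0)" if "poly_in M f" for b f
    using that by (cases b) (simp_all add: poly_in_const)
  have dm: "poly_in M (\<lambda>t. dmonomial_at \<alpha> l (x t))" "poly_in M (\<lambda>t. dmonomial_at \<alpha> l (y t))" for l
    unfolding dmonomial_at_def
    by (intro poly_in_mult[OF poly_in_mult] poly_in_const poly_in_prod poly_in_power assms)+
  show ?thesis
    unfolding k
    by (cases \<rho>) (simp_all add: if_zero poly_in_const poly_in_diff poly_in_mult m dm assms)
qed

lemma poly_in_row_rhs:
  assumes "poly_in M c" "\<And>i. poly_in M (\<lambda>t. L t i)" "\<And>i. poly_in M (\<lambda>t. L' t i)"
  shows "poly_in M (\<lambda>t. row_rhs r (c t) (L t) (L' t) \<rho>)"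
  by (cases \<rho>) (simp_all add: poly_in_const poly_in_mult poly_in_sum assms)

text \<open>A relation \<open>\<eta>\<close> is extended by zero outside \<open>R\<close>, so that
  one formula covers every selection of rows.\<close>

definition independent_rows ::
    "nat \<Rightarrow> nat \<Rightarrow> real ^ 'n \<Rightarrow> real ^ 'n \<Rightarrow> (nat \<Rightarrow> real) \<Rightarrow> (nat \<Rightarrow> real) \<Rightarrow> 'n::finite row set \<Rightarrow> bool" where
  "independent_rows d r x y L L' R \<longleftrightarrow>
    (\<forall>\<eta>. (\<forall>\<rho>. \<rho> \<notin> R \<longrightarrow> \<eta> \<rho> = 0) \<longrightarrow>
      (\<forall>i\<in>{1..r}. \<forall>\<alpha>\<in>multi_indices d.
         two_point_functional (\<eta> (Val i) - \<eta> (Dif i) + L i * \<eta> Wval)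
           (\<eta> (Val2 i) + \<eta> (Dif i) + L' i * \<eta> Wval2)
           (\<lambda>l. L i * \<eta> (Grad l)) (\<lambda>l. L' i * \<eta> (Grad2 l)) x y \<alpha> = 0) \<longrightarrow>
      (\<forall>\<rho>. \<eta> \<rho> = 0))"

text \<open>Leaves two checks for each case: fewer parameters than rows, and independence of the
  rows at the parameter values that occur.\<close>

lemma alg_null_two_points:
  fixes x y :: "('m \<Rightarrow> real) \<Rightarrow> real ^ 'n::finite"
  assumes "finite M" "R \<subseteq> all_rows r" "card M < card R"
    and "\<And>j. poly_in M (\<lambda>t. x t $ j)" "\<And>j. poly_in M (\<lambda>t. y t $ j)" "poly_in M c"
    and "\<And>i. poly_in M (\<lambda>t. L t i)" "\<And>i. poly_in M (\<lambda>t. L' t i)"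
  shows "alg_null (coeff_indices d r) {u. \<exists>t. independent_rows d r (x t) (y t) (L t) (L' t) R \<and>
    (\<forall>\<rho>\<in>R. row_value d r u (x t) (y t) (L t) (L' t) \<rho> = row_rhs r (c t) (L t) (L' t) \<rho>)}"
proof -
  let ?A = "\<lambda>\<rho> k t. row_coeff (x t) (y t) (L t) (L' t) \<rho> k"
  let ?b = "\<lambda>\<rho> t. row_rhs r (c t) (L t) (L' t) \<rho>"
  have "finite R" using finite_subset[OF assms(2) finite_all_rows] .
  then have "alg_null (coeff_indices d r) {u. \<exists>t.
      (\<forall>\<eta>. (\<forall>k\<in>coeff_indices d r. (\<Sum>\<rho>\<in>R. \<eta> \<rho> * ?A \<rho> k t) = 0) \<longrightarrow> (\<forall>\<rho>\<in>R. \<eta> \<rho> = 0)) \<and>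
      (\<forall>\<rho>\<in>R. (\<Sum>k\<in>coeff_indices d r. ?A \<rho> k t * u k) = ?b \<rho> t)}"
    using assms finite_coeff_indices
    by (intro alg_null_linear_system poly_in_row_coeff poly_in_row_rhs)
  then show ?thesis
  proof (rule alg_null_subset, intro subsetI, elim CollectE exE conjE)
    fix u t
    assume ind: "independent_rows d r (x t) (y t) (L t) (L' t) R"
      and eqs: "\<forall>\<rho>\<in>R. row_value d r u (x t) (y t) (L t) (L' t) \<rho> = ?b \<rho> t"
    have "\<forall>\<rho>\<in>R. \<eta> \<rho> = 0"
      if \<eta>: "\<forall>k\<in>coeff_indices d r. (\<Sum>\<rho>\<in>R. \<eta> \<rho> * ?A \<rho> k t) = 0" for \<eta>
    proof -
      define \<theta> where "\<theta> \<rho> = (if \<rho> \<in> R then \<eta> \<rho> else 0)" for \<rho>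
      have "two_point_functional (\<theta> (Val i) - \<theta> (Dif i) + L t i * \<theta> Wval)
           (\<theta> (Val2 i) + \<theta> (Dif i) + L' t i * \<theta> Wval2)
           (\<lambda>l. L t i * \<theta> (Grad l)) (\<lambda>l. L' t i * \<theta> (Grad2 l)) (x t) (y t) \<alpha> = 0"
        if i: "i \<in> {1..r}" and \<alpha>: "\<alpha> \<in> multi_indices d" for i \<alpha>
      proof -
        have delta: "(\<Sum>k\<in>{1..r}. \<theta> (f k) * (if i = k then z else 0)) = \<theta> (f i) * z" for f z
          using i by (simp add: if_distrib[of "\<lambda>x. _ * x"] cong: if_cong)
        have "0 = (\<Sum>\<rho>\<in>R. \<eta> \<rho> * ?A \<rho> (i, \<alpha>) t)"
          using \<eta> i \<alpha> by (simp add: coeff_indices_def)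
        also have "\<dots> = (\<Sum>\<rho>\<in>all_rows r. \<theta> \<rho> * ?A \<rho> (i, \<alpha>) t)"
          using assms(2) by (intro sum.mono_neutral_cong_left finite_all_rows) (auto simp: \<theta>_def)
        also have "\<dots> = two_point_functional (\<theta> (Val i) - \<theta> (Dif i) + L t i * \<theta> Wval)
           (\<theta> (Val2 i) + \<theta> (Dif i) + L' t i * \<theta> Wval2)
           (\<lambda>l. L t i * \<theta> (Grad l)) (\<lambda>l. L' t i * \<theta> (Grad2 l)) (x t) (y t) \<alpha>"
          unfolding sum_all_rows row_coeff.simps delta two_point_functional_def
          by (simp add: algebra_simps)
        finally show ?thesis by simp
      qed
      moreover have "\<forall>\<rho>. \<rho> \<notin> R \<longrightarrow> \<theta> \<rho> = 0" by (simp add: \<theta>_def)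
      ultimately have "\<forall>\<rho>. \<theta> \<rho> = 0"
        using ind unfolding independent_rows_def by blast
      then show ?thesis by (metis \<theta>_def)
    qed
    moreover have "\<forall>\<rho>\<in>R. (\<Sum>k\<in>coeff_indices d r. ?A \<rho> k t * u k) = ?b \<rho> t"
      using eqs row_value_eq assms(2) by fastforce
    ultimately show "u \<in> {u. \<exists>t.
      (\<forall>\<eta>. (\<forall>k\<in>coeff_indices d r. (\<Sum>\<rho>\<in>R. \<eta> \<rho> * ?A \<rho> k t) = 0) \<longrightarrow> (\<forall>\<rho>\<in>R. \<eta> \<rho> = 0)) \<and>
      (\<forall>\<rho>\<in>R. (\<Sum>k\<in>coeff_indices d r. ?A \<rho> k t * u k) = ?b \<rho> t)}"
      by blast
  qed
qed

section \<open>Critical points of continuous selections\<close>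

text \<open>Let \<sigma> be the last point where \<open>\<phi>\<close> is at most
  \<open>\<phi> a\<close>. Functions inactive at \<sigma> stay inactive nearby, so just to the right
  \<open>\<phi>\<close> takes values of functions that agree with it at \<sigma> and do not
  increase, contradicting the choice of \<sigma>.\<close>

lemma continuous_selection_nonincreasing:
  fixes \<phi> :: "real \<Rightarrow> real"
  assumes "a \<le> b" "continuous_on {a..b} \<phi>" "finite A" "\<And>i. i \<in> A \<Longrightarrow> continuous_on {a..b} (\<psi> i)"
    and sel: "\<And>s. s \<in> {a..b} \<Longrightarrow> \<exists>i\<in>A. \<phi> s = \<psi> i s"
    and dec: "\<And>i s s'. i \<in> A \<Longrightarrow> a \<le> s \<Longrightarrow> s \<le> s' \<Longrightarrow> s' \<le> b \<Longrightarrow> \<psi> i s' \<le> \<psi> i s"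
  shows "\<phi> b \<le> \<phi> a"
proof (rule ccontr)
  assume less: "\<not> \<phi> b \<le> \<phi> a"
  define S where "S = {s \<in> {a..b}. \<phi> s \<le> \<phi> a}"
  have "closed ({a..b} \<inter> \<phi> -` {..\<phi> a})"
    using assms(2) by (intro continuous_closed_preimage) auto
  then have "closed S" by (auto simp: S_def vimage_def Int_def)
  moreover have "bounded S" by (rule bounded_subset[of "{a..b}"]) (auto simp: S_def)
  ultimately have "compact S" by (simp add: compact_eq_bounded_closed)
  moreover have "a \<in> S" using assms(1) by (simp add: S_def)
  ultimately obtain \<sigma> where \<sigma>: "\<sigma> \<in> S" "\<And>s. s \<in> S \<Longrightarrow> s \<le> \<sigma>"
    using compact_attains_sup[of S] by blast
  have \<sigma>b: "\<sigma> \<in> {a..b}" "\<sigma> < b" "\<phi> \<sigma> \<le> \<phi> a"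
    using \<sigma>(1) less by (auto simp: S_def less_le)
  have "\<forall>\<^sub>F s in at \<sigma> within {a..b}. \<psi> i \<sigma> \<noteq> \<phi> \<sigma> \<longrightarrow> \<psi> i s \<noteq> \<phi> s" if "i \<in> A" for i
  proof (cases "\<psi> i \<sigma> = \<phi> \<sigma>")
    case False
    have "((\<lambda>s. \<psi> i s - \<phi> s) \<longlongrightarrow> \<psi> i \<sigma> - \<phi> \<sigma>) (at \<sigma> within {a..b})"
      using assms(2,4) that \<sigma>b(1) by (intro tendsto_diff) (auto simp: continuous_on)
    then have "\<forall>\<^sub>F s in at \<sigma> within {a..b}. \<psi> i s - \<phi> s \<noteq> 0"
      using False by (intro tendsto_imp_eventually_ne) auto
    then show ?thesis by eventually_elim simp
  qed simp
  then have "\<forall>\<^sub>F s in at \<sigma> within {a..b}. \<forall>i\<in>A. \<psi> i \<sigma> \<noteq> \<phi> \<sigma> \<longrightarrow> \<psi> i s \<noteq> \<phi> s"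
    using assms(3) by (simp add: eventually_ball_finite)
  then obtain \<delta> where \<delta>: "\<delta> > 0"
    "\<And>s. s \<in> {a..b} \<Longrightarrow> s \<noteq> \<sigma> \<Longrightarrow> dist s \<sigma> < \<delta> \<Longrightarrow> \<forall>i\<in>A. \<psi> i \<sigma> \<noteq> \<phi> \<sigma> \<longrightarrow> \<psi> i s \<noteq> \<phi> s"
    unfolding eventually_at by auto
  define s where "s = min b (\<sigma> + \<delta> / 2)"
  have s: "s \<in> {a..b}" "\<sigma> < s" "dist s \<sigma> < \<delta>"
    using \<sigma>b \<delta>(1) by (auto simp: s_def dist_real_def min_def)
  obtain i where i: "i \<in> A" "\<phi> s = \<psi> i s" using sel s(1) by blast
  then have "\<psi> i \<sigma> = \<phi> \<sigma>" using \<delta>(2)[of s] s by auto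
  moreover have "\<psi> i s \<le> \<psi> i \<sigma>" using dec i(1) s \<sigma>b(1) by auto
  ultimately have "\<phi> s \<le> \<phi> a" using i(2) \<sigma>b(3) by simp
  then have "s \<in> S" using s(1) by (simp add: S_def)
  then show False using \<sigma>(2) s(2) by force
qed

text \<open>Otherwise a hyperplane separates 0 from the active gradients and gives a direction
  \<open>v\<close> in which all active functions decrease at rate at least \<open>b\<close> near
  \<open>x\<close>. The selection inherits this rate, so its Clarke derivative along
  \<open>v\<close> is at most \<open>- b\<close>.\<close>

lemma critical_point_of_selection:
  fixes f :: "'a::euclidean_space \<Rightarrow> real"
  assumes "finite I" "continuous_on UNIV f" and sel: "\<And>y. \<exists>i\<in>I. f y = g i y"
    and der: "\<And>i y. (g i has_derivative (\<lambda>v. v \<bullet> G i y)) (at y)"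
    and cont: "\<And>i. continuous_on UNIV (G i)"
    and crit: "critical_point f x"
  shows "0 \<in> convex hull ((\<lambda>i. G i x) ` {i \<in> I. g i x = f x})"
proof (rule ccontr)
  define A where "A = {i \<in> I. g i x = f x}"
  assume "0 \<notin> convex hull ((\<lambda>i. G i x) ` {i \<in> I. g i x = f x})"
  then have "0 \<notin> convex hull ((\<lambda>i. G i x) ` A)" by (simp add: A_def)
  moreover have "finite A" using assms(1) by (simp add: A_def)
  then have "closed (convex hull ((\<lambda>i. G i x) ` A))"
    by (intro compact_imp_closed finite_imp_compact_convex_hull) simp
  ultimately obtain a b where ab: "b > 0" "\<And>z. z \<in> convex hull ((\<lambda>i. G i x) ` A) \<Longrightarrow> a \<bullet> z > b"
    using separating_hyperplane_closed_0[OF convex_convex_hull] by metis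
  define v where "v = - a"
  have gcont: "isCont (g i) y" for i y
    using der has_derivative_continuous by blast
  have fcont: "isCont f y" for y
    using assms(2) by (simp add: continuous_on_eq_continuous_at)
  have "\<forall>\<^sub>F y in nhds x. v \<bullet> G i y < - b" if "i \<in> A" for i
  proof -
    have "G i x \<in> convex hull ((\<lambda>i. G i x) ` A)" using that by (intro hull_inc) auto
    then have "v \<bullet> G i x < - b" using ab(2) by (simp add: v_def)
    moreover have "isCont (\<lambda>y. v \<bullet> G i y) x"
      using cont by (intro continuous_intros) (simp add: continuous_on_eq_continuous_at)
    then have "((\<lambda>y. v \<bullet> G i y) \<longlongrightarrow> v \<bullet> G i x) (nhds x)"
      using tendsto_at_iff_tendsto_nhds[of "\<lambda>y. v \<bullet> G i y" x] by (simp add: isCont_def)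
    ultimately show ?thesis by (metis order_tendstoD(2))
  qed
  then have "\<forall>\<^sub>F y in nhds x. \<forall>i\<in>A. v \<bullet> G i y < - b"
    using \<open>finite A\<close> by (simp add: eventually_ball_finite)
  moreover have "\<forall>\<^sub>F y in nhds x. g i y \<noteq> f y" if "i \<in> I - A" for i
  proof -
    have "((\<lambda>y. g i y - f y) \<longlongrightarrow> g i x - f x) (nhds x)"
      using gcont[of x i] fcont[of x]
      by (intro tendsto_diff) (simp_all add: isCont_def tendsto_at_iff_tendsto_nhds)
    moreover have "g i x - f x \<noteq> 0" using that by (simp add: A_def)
    ultimately have "\<forall>\<^sub>F y in nhds x. g i y - f y \<noteq> 0" by (rule tendsto_imp_eventually_ne)
    then show ?thesis by eventually_elim simp
  qed
  then have "\<forall>\<^sub>F y in nhds x. \<forall>i\<in>I - A. g i y \<noteq> f y"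
    using assms(1) by (simp add: eventually_ball_finite)
  ultimately have "\<forall>\<^sub>F y in nhds x. (\<forall>i\<in>A. v \<bullet> G i y < - b) \<and> (\<forall>i\<in>I - A. g i y \<noteq> f y)"
    by (rule eventually_conj)
  then obtain e where e: "e > 0"
    "\<And>y. dist y x < e \<Longrightarrow> (\<forall>i\<in>A. v \<bullet> G i y < - b) \<and> (\<forall>i\<in>I - A. g i y \<noteq> f y)"
    unfolding eventually_nhds_metric by blast
  have quot: "(f (y + t *\<^sub>R v) - f y) / t \<le> - b"
    if y: "dist y x < e / 2" and t: "0 < t" "t < e / (2 * (norm v + 1))" for y t
  proof -
    have near: "dist (y + s *\<^sub>R v) x < e" if "s \<in> {0..t}" for s
    proof -
      have "s * norm v \<le> t * (norm v + 1)"
        using that t(1) by (intro mult_mono) auto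
      also have "\<dots> < e / 2"
        using t(2) by (simp add: field_simps add_pos_nonneg)
      finally have "norm (s *\<^sub>R v) < e / 2" using that by simp
      moreover have "dist (y + s *\<^sub>R v) x \<le> norm (s *\<^sub>R v) + dist y x"
        using norm_triangle_ineq[of "s *\<^sub>R v" "y - x"] by (simp add: dist_norm algebra_simps)
      ultimately show ?thesis using y by simp
    qed
    have der_seg: "((\<lambda>s. g i (y + s *\<^sub>R v) + b * s) has_real_derivative v \<bullet> G i (y + s *\<^sub>R v) + b) (at s)"
      for i s
    proof -
      have "((\<lambda>s. y + s *\<^sub>R v) has_derivative (\<lambda>h. h *\<^sub>R v)) (at s)"
        by (auto intro!: derivative_eq_intros)
      from diff_chain_at[OF this der[of i]]
      have "((\<lambda>s. g i (y + s *\<^sub>R v)) has_derivative (\<lambda>h. (v \<bullet> G i (y + s *\<^sub>R v)) * h)) (at s)"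
        by (simp add: o_def mult.commute)
      then have "((\<lambda>s. g i (y + s *\<^sub>R v)) has_real_derivative v \<bullet> G i (y + s *\<^sub>R v)) (at s)"
        by (simp add: has_field_derivative_def)
      then show ?thesis by (auto intro!: derivative_eq_intros)
    qed
    \<comment> \<open>Adding \<open>b * s\<close> turns the rate of decrease into plain
      monotonicity.\<close>
    have "f (y + t *\<^sub>R v) + b * t \<le> f (y + 0 *\<^sub>R v) + b * 0"
    proof (rule continuous_selection_nonincreasing[where \<phi> = "\<lambda>s. f (y + s *\<^sub>R v) + b * s"
          and \<psi> = "\<lambda>i s. g i (y + s *\<^sub>R v) + b * s" and A = A])
      show "continuous_on {0..t} (\<lambda>s. f (y + s *\<^sub>R v) + b * s)"
        by (intro continuous_intros continuous_on_compose2[OF assms(2)]) auto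
      show "continuous_on {0..t} (\<lambda>s. g i (y + s *\<^sub>R v) + b * s)" for i
        using der_seg by (meson DERIV_isCont continuous_at_imp_continuous_on)
      show "\<exists>i\<in>A. f (y + s *\<^sub>R v) + b * s = g i (y + s *\<^sub>R v) + b * s" if "s \<in> {0..t}" for s
      proof -
        obtain i where "i \<in> I" "f (y + s *\<^sub>R v) = g i (y + s *\<^sub>R v)" using sel by blast
        moreover have "\<forall>i\<in>I - A. g i (y + s *\<^sub>R v) \<noteq> f (y + s *\<^sub>R v)"
          using e(2)[OF near[OF that]] by blast
        ultimately show ?thesis by force
      qed
      show "g i (y + s' *\<^sub>R v) + b * s' \<le> g i (y + s *\<^sub>R v) + b * s"
        if "i \<in> A" "0 \<le> s" "s \<le> s'" "s' \<le> t" for i s s'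
      proof (rule DERIV_nonpos_imp_nonincreasing[OF that(3)])
        fix w assume "s \<le> w" "w \<le> s'"
        then have "v \<bullet> G i (y + w *\<^sub>R v) < - b" using e(2) near that by auto
        then show "\<exists>z. ((\<lambda>s. g i (y + s *\<^sub>R v) + b * s) has_real_derivative z) (at w) \<and> z \<le> 0"
          using der_seg[of i w] by (intro exI conjI) auto
      qed
    qed (use t \<open>finite A\<close> in auto)
    then have "f (y + t *\<^sub>R v) - f y \<le> - b * t" by simp
    then show ?thesis using t(1) by (simp add: divide_le_eq)
  qed
  have "\<forall>\<^sub>F z in nhds x \<times>\<^sub>F at_right 0. (case z of (y, t) \<Rightarrow> ereal ((f (y + t *\<^sub>R v) - f y) / t)) \<le> ereal (- b)"
    unfolding eventually_prod_filter
  proof (intro exI conjI allI impI)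
    show "\<forall>\<^sub>F y in nhds x. dist y x < e / 2"
      unfolding eventually_nhds_metric using e(1) by (intro exI[of _ "e / 2"]) auto
    have "e / (2 * (norm v + 1)) > 0" using e(1) by (simp add: add_nonneg_pos)
    then show "\<forall>\<^sub>F t in at_right 0. t \<in> {0<..<e / (2 * (norm v + 1))}"
      by (rule eventually_at_right_real)
  qed (use quot in auto)
  then have "clarke_deriv f x v \<le> ereal (- b)"
    unfolding clarke_deriv_def by (rule Limsup_bounded)
  moreover have "ereal (0 \<bullet> v) \<le> clarke_deriv f x v"
    using crit unfolding critical_point_def clarke_subdifferential_def by blast
  ultimately have "ereal (0 \<bullet> v) \<le> ereal (- b)" by (rule order_trans[rotated])
  then show False using ab(1) by simp
qed

lemma optimal_solution_imp_critical_point: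
  assumes "optimal_solution f x"
  shows "critical_point f x"
  unfolding critical_point_def clarke_subdifferential_def
proof (intro CollectI allI)
  fix v
  show "ereal (0 \<bullet> v) \<le> clarke_deriv f x v"
  proof (rule ccontr)
    assume "\<not> ?thesis"
    then have "clarke_deriv f x v < 0" by (simp add: zero_ereal_def)
    then have "\<forall>\<^sub>F z in nhds x \<times>\<^sub>F at_right 0. (case z of (y, t) \<Rightarrow> ereal ((f (y + t *\<^sub>R v) - f y) / t)) < 0"
      unfolding clarke_deriv_def by (rule Limsup_lessD)
    then obtain P Q where P: "\<forall>\<^sub>F y in nhds x. P y" and Q: "\<forall>\<^sub>F t::real in at_right 0. Q t"
      and PQ: "\<And>y t. P y \<Longrightarrow> Q t \<Longrightarrow> ereal ((f (y + t *\<^sub>R v) - f y) / t) < 0"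
      unfolding eventually_prod_filter by auto
    have "\<forall>\<^sub>F t::real in at_right 0. Q t \<and> t > 0"
      using Q eventually_at_right_less by (rule eventually_conj)
    then obtain t where "Q t" "t > 0"
      using eventually_happens'[OF trivial_limit_at_right_real] by blast
    \<comment> \<open>The upper limit admits \<open>y = x\<close>, where minimality makes the
      quotient nonnegative.\<close>
    moreover have "P x" using P by (rule eventually_nhds_x_imp_x)
    ultimately have "f (x + t *\<^sub>R v) < f x"
      using PQ[of x t] by (simp add: zero_ereal_def divide_less_0_iff)
    then show False using assms unfolding optimal_solution_def by (meson not_less)
  qed
qed

section \<open>Independence of the critical point conditions\<close>

lemma independent_rowsI:
  fixes x y :: "real ^ 'n::finite"
  assumes "\<And>\<eta> \<rho>. (\<And>\<rho>. \<rho> \<notin> R \<Longrightarrow> \<eta> \<rho> = 0) \<Longrightarrow>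
      (\<And>i \<alpha>. i \<in> {1..r} \<Longrightarrow> \<alpha> \<in> multi_indices d \<Longrightarrow>
         two_point_functional (\<eta> (Val i) - \<eta> (Dif i) + L i * \<eta> Wval)
           (\<eta> (Val2 i) + \<eta> (Dif i) + L' i * \<eta> Wval2)
           (\<lambda>l. L i * \<eta> (Grad l)) (\<lambda>l. L' i * \<eta> (Grad2 l)) x y \<alpha> = 0) \<Longrightarrow> \<rho> \<in> R \<Longrightarrow> \<eta> \<rho> = 0"
  shows "independent_rows d r x y L L' R"
  unfolding independent_rows_def
proof (intro allI impI)
  fix \<eta> :: "'n row \<Rightarrow> real" and \<rho> :: "'n row"
  assume "\<forall>\<rho>. \<rho> \<notin> R \<longrightarrow> \<eta> \<rho> = 0" "\<forall>i\<in>{1..r}. \<forall>\<alpha>\<in>multi_indices d.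
         two_point_functional (\<eta> (Val i) - \<eta> (Dif i) + L i * \<eta> Wval)
           (\<eta> (Val2 i) + \<eta> (Dif i) + L' i * \<eta> Wval2)
           (\<lambda>l. L i * \<eta> (Grad l)) (\<lambda>l. L' i * \<eta> (Grad2 l)) x y \<alpha> = 0"
  then show "\<eta> \<rho> = 0" using assms[of \<eta> \<rho>] by (cases "\<rho> \<in> R") blast+
qed

text \<open>Each index \<open>i\<close> carries a multiple of the trapezoidal rule, with factor
  \<open>\<eta> (Val2 i)\<close>. For d = 2, comparing its parts at \<open>x\<close> and
  \<open>y\<close> for \<open>i\<^sub>0\<close> and \<open>j\<^sub>0\<close> gives a homogeneous 2
  by 2 system for \<open>\<eta> (Grad l)\<close> and \<open>\<eta> (Grad2 l)\<close>, singular only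
  if \<open>L j\<^sub>0 * L' i\<^sub>0 = 1\<close>.\<close>

lemma independent_rows_two_points:
  fixes x y :: "real ^ 'n::finite"
  assumes "x \<noteq> y" "J \<subseteq> {1..r}" "J' \<subseteq> {1..r}" "i\<^sub>0 \<in> J" "j\<^sub>0 \<in> J'" "L i\<^sub>0 = 1" "L' j\<^sub>0 = 1"
    and "d \<ge> 2" "d \<ge> 3 \<or> L j\<^sub>0 * L' i\<^sub>0 \<noteq> 1"
  shows "independent_rows d r x y L L' (Val ` J \<union> Val2 ` J' \<union> range Grad \<union> range Grad2)"
proof (rule independent_rowsI)
  fix \<eta> :: "'n row \<Rightarrow> real" and \<rho> :: "'n row"
  assume out: "\<And>\<rho>. \<rho> \<notin> Val ` J \<union> Val2 ` J' \<union> range Grad \<union> range Grad2 \<Longrightarrow> \<eta> \<rho> = 0"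
    and tp: "\<And>i \<alpha>. i \<in> {1..r} \<Longrightarrow> \<alpha> \<in> multi_indices d \<Longrightarrow>
         two_point_functional (\<eta> (Val i) - \<eta> (Dif i) + L i * \<eta> Wval)
           (\<eta> (Val2 i) + \<eta> (Dif i) + L' i * \<eta> Wval2)
           (\<lambda>l. L i * \<eta> (Grad l)) (\<lambda>l. L' i * \<eta> (Grad2 l)) x y \<alpha> = 0"
    and \<rho>: "\<rho> \<in> Val ` J \<union> Val2 ` J' \<union> range Grad \<union> range Grad2"
  obtain k where k: "y $ k \<noteq> x $ k" using assms(1) by (metis vec_eq_iff)
  have [simp]: "\<eta> (Dif i) = 0" "\<eta> Wval = 0" "\<eta> Wval2 = 0" for i by (auto intro!: out)
  have tp': "two_point_functional (\<eta> (Val i)) (\<eta> (Val2 i)) (\<lambda>l. L i * \<eta> (Grad l))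
      (\<lambda>l. L' i * \<eta> (Grad2 l)) x y \<alpha> = 0" if "i \<in> {1..r}" "\<alpha> \<in> multi_indices d" for i \<alpha>
    using tp[OF that] by simp
  have ij: "i\<^sub>0 \<in> {1..r}" "j\<^sub>0 \<in> {1..r}" using assms by auto
  have val: "\<eta> (Val i) = - \<eta> (Val2 i)" if "i \<in> {1..r}" for i
    using two_point_degree_0[where d = d, OF tp'[OF that]] by simp
  have grad: "L i * \<eta> (Grad l) = - \<eta> (Val2 i) / 2 * (y $ l - x $ l)"
      "L' i * \<eta> (Grad2 l) = - \<eta> (Val2 i) / 2 * (y $ l - x $ l)" if "i \<in> {1..r}" for i l
    using two_point_degree_2[where d = d, OF tp'[OF that] assms(8) k] by simp_all
  have zero: "\<eta> (Grad l) = 0 \<and> \<eta> (Grad2 l) = 0" for l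
  proof (cases "d \<ge> 3")
    case True
    show ?thesis
      using two_point_degree_3(3,4)[where d = d, OF tp'[OF ij(1)] True k, of l]
        two_point_degree_3(3,4)[where d = d, OF tp'[OF ij(2)] True k, of l] assms(6,7) by simp
  next
    case False
    have "\<eta> (Grad l) = L' i\<^sub>0 * \<eta> (Grad2 l)" "L j\<^sub>0 * \<eta> (Grad l) = \<eta> (Grad2 l)"
      using trans[OF grad(1)[OF ij(1)] grad(2)[OF ij(1), symmetric], of l]
        trans[OF grad(1)[OF ij(2)] grad(2)[OF ij(2), symmetric], of l] assms(6,7)
      by (simp_all only: mult_1)
    moreover from this have "(1 - L j\<^sub>0 * L' i\<^sub>0) * \<eta> (Grad l) = 0" by algebra
    ultimately show ?thesis using False assms(9) by auto
  qed
  have val2: "\<eta> (Val2 i) = 0" if "i \<in> {1..r}" for i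
    using grad(1)[OF that, of k] zero k by simp
  show "\<eta> \<rho> = 0" using \<rho> zero val val2 assms(2,3) by auto
qed

text \<open>Without \<open>Val2\<close> rows the value at \<open>y\<close> has coefficient zero,
  which excludes the trapezoidal relation even for equal weights.\<close>

lemma independent_rows_line:
  fixes x y :: "real ^ 'n::finite"
  assumes "y $ k \<noteq> x $ k" "J \<subseteq> {1..r}" "i\<^sub>0 \<in> J" "L i\<^sub>0 = 1" "d \<ge> 2"
  shows "independent_rows d r x y L L (Val ` J \<union> range Grad \<union> range Grad2)"
proof (rule independent_rowsI)
  fix \<eta> :: "'n row \<Rightarrow> real" and \<rho> :: "'n row"
  assume out: "\<And>\<rho>. \<rho> \<notin> Val ` J \<union> range Grad \<union> range Grad2 \<Longrightarrow> \<eta> \<rho> = 0"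
    and tp: "\<And>i \<alpha>. i \<in> {1..r} \<Longrightarrow> \<alpha> \<in> multi_indices d \<Longrightarrow>
         two_point_functional (\<eta> (Val i) - \<eta> (Dif i) + L i * \<eta> Wval)
           (\<eta> (Val2 i) + \<eta> (Dif i) + L i * \<eta> Wval2)
           (\<lambda>l. L i * \<eta> (Grad l)) (\<lambda>l. L i * \<eta> (Grad2 l)) x y \<alpha> = 0"
    and \<rho>: "\<rho> \<in> Val ` J \<union> range Grad \<union> range Grad2"
  have [simp]: "\<eta> (Dif i) = 0" "\<eta> (Val2 i) = 0" "\<eta> Wval = 0" "\<eta> Wval2 = 0" for i
    by (auto intro!: out)
  have tp': "two_point_functional (\<eta> (Val i)) 0 (\<lambda>l. L i * \<eta> (Grad l))
      (\<lambda>l. L i * \<eta> (Grad2 l)) x y \<alpha> = 0" if "i \<in> {1..r}" "\<alpha> \<in> multi_indices d" for i \<alpha>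
    using tp[OF that] by simp
  have val: "\<eta> (Val i) = 0" if "i \<in> {1..r}" for i
    using two_point_degree_0[where d = d, OF tp'[OF that]] by simp
  have "i\<^sub>0 \<in> {1..r}" using assms by auto
  then have "\<eta> (Grad l) = 0" "\<eta> (Grad2 l) = 0" for l
    using two_point_degree_2[where d = d, OF tp' assms(5,1), of i\<^sub>0 l] assms(4) by simp_all
  then show "\<eta> \<rho> = 0" using \<rho> val assms(2) by auto
qed

text \<open>Weighted sums of affine polynomials with zero gradient are constant, so one base point
  serves for both. The value rows and the gradient rows lead to the same invertible 2 by 2
  system.\<close>

lemma independent_rows_affine_distinct_weights:
  fixes x :: "real ^ 'n::finite"
  assumes "i\<^sub>0 \<in> {1..r}" "j\<^sub>0 \<in> {1..r}" "L i\<^sub>0 = 1" "L' j\<^sub>0 = 1" "d \<ge> 1" "L j\<^sub>0 * L' i\<^sub>0 \<noteq> 1"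
  shows "independent_rows d r x x L L' ({Wval, Wval2} \<union> range Grad \<union> range Grad2)"
proof (rule independent_rowsI)
  fix \<eta> :: "'n row \<Rightarrow> real" and \<rho> :: "'n row"
  assume out: "\<And>\<rho>. \<rho> \<notin> {Wval, Wval2} \<union> range Grad \<union> range Grad2 \<Longrightarrow> \<eta> \<rho> = 0"
    and tp: "\<And>i \<alpha>. i \<in> {1..r} \<Longrightarrow> \<alpha> \<in> multi_indices d \<Longrightarrow>
         two_point_functional (\<eta> (Val i) - \<eta> (Dif i) + L i * \<eta> Wval)
           (\<eta> (Val2 i) + \<eta> (Dif i) + L' i * \<eta> Wval2)
           (\<lambda>l. L i * \<eta> (Grad l)) (\<lambda>l. L' i * \<eta> (Grad2 l)) x x \<alpha> = 0"
    and \<rho>: "\<rho> \<in> {Wval, Wval2} \<union> range Grad \<union> range Grad2"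
  have [simp]: "\<eta> (Dif i) = 0" "\<eta> (Val i) = 0" "\<eta> (Val2 i) = 0" for i by (auto intro!: out)
  have solve: "a = 0 \<and> b = 0" if "L i\<^sub>0 * a + L' i\<^sub>0 * b = 0" "L j\<^sub>0 * a + L' j\<^sub>0 * b = 0" for a b :: real
  proof -
    have "a = - L' i\<^sub>0 * b" "b = - L j\<^sub>0 * a" using that assms(3,4) by simp_all
    moreover from this have "(1 - L j\<^sub>0 * L' i\<^sub>0) * a = 0" by algebra
    ultimately show ?thesis using assms(6) by auto
  qed
  have "\<eta> Wval = 0 \<and> \<eta> Wval2 = 0"
    using two_point_degree_0[where d = d, OF tp[OF assms(1)]] two_point_degree_0[where d = d, OF tp[OF assms(2)]]
    by (intro solve) simp_all
  moreover have "\<eta> (Grad l) = 0 \<and> \<eta> (Grad2 l) = 0" for l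
    using two_point_degree_1[where d = d, OF tp[OF assms(1)] assms(5), of l]
      two_point_degree_1[where d = d, OF tp[OF assms(2)] assms(5), of l]
    by (intro solve) simp_all
  ultimately show "\<eta> \<rho> = 0" using \<rho> by auto
qed

text \<open>\<open>w\<close> is the direction between the two points. \<open>Dif i\<^sub>0\<close>
  is left out because on affine polynomials the \<open>Dif\<close> rows weighted by \<open>L\<close>
  add up to the \<open>Grad\<close> rows weighted by \<open>w\<close>.\<close>

lemma independent_rows_affine_same_weights:
  fixes w :: "real ^ 'n::finite"
  assumes "J \<subseteq> {1..r}" "i\<^sub>0 \<in> J" "L i\<^sub>0 = 1" "d \<ge> 1" "w $ k = 1"
  shows "independent_rows d r 0 w L (\<lambda>_. 0) (Dif ` (J - {i\<^sub>0}) \<union> range Grad)"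
proof (rule independent_rowsI)
  fix \<eta> :: "'n row \<Rightarrow> real" and \<rho> :: "'n row"
  assume out: "\<And>\<rho>. \<rho> \<notin> Dif ` (J - {i\<^sub>0}) \<union> range Grad \<Longrightarrow> \<eta> \<rho> = 0"
    and tp: "\<And>i \<alpha>. i \<in> {1..r} \<Longrightarrow> \<alpha> \<in> multi_indices d \<Longrightarrow>
         two_point_functional (\<eta> (Val i) - \<eta> (Dif i) + L i * \<eta> Wval)
           (\<eta> (Val2 i) + \<eta> (Dif i) + 0 * \<eta> Wval2)
           (\<lambda>l. L i * \<eta> (Grad l)) (\<lambda>l. 0 * \<eta> (Grad2 l)) 0 w \<alpha> = 0"
    and \<rho>: "\<rho> \<in> Dif ` (J - {i\<^sub>0}) \<union> range Grad"
  have [simp]: "\<eta> (Val i) = 0" "\<eta> (Val2 i) = 0" "\<eta> Wval = 0" "\<eta> (Dif i\<^sub>0) = 0" for i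
    by (auto intro!: out)
  have eq: "L i * \<eta> (Grad l) = - \<eta> (Dif i) * w $ l" if "i \<in> {1..r}" for i l
    using two_point_degree_1[where d = d, OF tp[OF that] assms(4), of l] by simp
  have grad: "\<eta> (Grad l) = 0" for l using eq[of i\<^sub>0 l] assms by auto
  then have "\<eta> (Dif i) = 0" if "i \<in> {1..r}" for i using eq[OF that, of k] assms(5) by simp
  then show "\<eta> \<rho> = 0" using \<rho> grad assms(1) by auto
qed

section \<open>Exceptional coefficient tuples\<close>

text \<open>Coordinates of the points, weights, and the common critical value. For equal weights
  with d = 2 or d = 1, \<open>PY\<close> holds a direction between the points.\<close>

datatype 'n param = PX 'n | PY 'n | PL nat | PL' nat | PC

text \<open>The entry at \<open>i\<^sub>0\<close> is the constant 1 and not a parameter, which saves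
  one parameter for each weight vector.\<close>

definition weight_of :: "(nat \<Rightarrow> 'm) \<Rightarrow> nat set \<Rightarrow> nat \<Rightarrow> ('m \<Rightarrow> real) \<Rightarrow> nat \<Rightarrow> real" where
  "weight_of P J i\<^sub>0 t i = (if i = i\<^sub>0 then 1 else if i \<in> J then t (P i) else 0)"

lemma poly_in_weight_of:
  assumes "P ` (J - {i\<^sub>0}) \<subseteq> M"
  shows "poly_in M (\<lambda>t. weight_of P J i\<^sub>0 t i)"
  using assms unfolding weight_of_def by (cases "i = i\<^sub>0"; cases "i \<in> J") auto

lemma weight_of_eq:
  assumes "L i\<^sub>0 = 1" "\<And>i. i \<notin> J \<Longrightarrow> L i = 0" "\<And>i. t (P i) = L i"
  shows "weight_of P J i\<^sub>0 t = L"
  using assms by (auto simp: weight_of_def fun_eq_iff)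

lemma card_rows_two_points:
  assumes "finite J" "finite J'"
  shows "card (Val ` J \<union> Val2 ` J' \<union> range Grad \<union> range Grad2 :: 'n::finite row set) =
    card J + card J' + 2 * CARD('n)"
  using assms by (subst card_Un_disjoint; (force simp: card_image inj_on_def)?)+

lemma card_rows_line:
  assumes "finite J"
  shows "card (Val ` J \<union> range Grad \<union> range Grad2 :: 'n::finite row set) = card J + 2 * CARD('n)"
  using assms by (subst card_Un_disjoint; (force simp: card_image inj_on_def)?)+

lemma card_rows_affine:
  "card ({Wval, Wval2} \<union> range Grad \<union> range Grad2 :: 'n::finite row set) = 2 + 2 * CARD('n)"
  by (subst card_Un_disjoint; (force simp: card_image inj_on_def)?)+

lemma card_rows_affine_same:
  assumes "finite J"
  shows "card (Dif ` J \<union> range Grad :: 'n::finite row set) = card J + CARD('n)"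
  using assms by (subst card_Un_disjoint; (force simp: card_image inj_on_def)?)+

lemma card_params:
  fixes A B :: "'n::finite set" and J J' :: "nat set"
  assumes "finite J" "finite J'"
  shows "card (PX ` A \<union> PY ` B \<union> PL ` J \<union> PL' ` J' \<union> {PC}) \<le>
      card A + card B + card J + card J' + 1"
proof -
  have "card (PX ` A \<union> PY ` B \<union> PL ` J \<union> PL' ` J' \<union> {PC}) \<le>
      card (PX ` A) + card (PY ` B) + card (PL ` J :: 'n param set) + card (PL' ` J' :: 'n param set) +
        card {PC :: 'n param}"
    by (intro order_trans[OF card_Un_le] add_mono) auto
  also have "\<dots> \<le> card A + card B + card J + card J' + 1"
    using assms by (intro add_mono card_image_le) auto
  finally show ?thesis .
qed

definition weights :: "nat \<Rightarrow> nat set \<Rightarrow> nat \<Rightarrow> (nat \<Rightarrow> real) \<Rightarrow> bool" where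
  "weights r J i\<^sub>0 L \<longleftrightarrow> J \<subseteq> {1..r} \<and> i\<^sub>0 \<in> J \<and> L i\<^sub>0 = 1 \<and> (\<forall>i. i \<notin> J \<longrightarrow> L i = 0)"

definition stationary :: "nat \<Rightarrow> nat \<Rightarrow> (nat \<times> ('n::finite \<Rightarrow> nat) \<Rightarrow> real) \<Rightarrow> real ^ 'n \<Rightarrow> (nat \<Rightarrow> real) \<Rightarrow> bool" where
  "stationary d r u x L \<longleftrightarrow> (\<forall>l. (\<Sum>i\<in>{1..r}. L i * poly_gradient d u i x $ l) = 0)"

section \<open>Parameter counts for the four types of coincidence\<close>

lemma alg_null_two_critical_points:
  assumes "d \<ge> 2" "J \<subseteq> {1..r}" "J' \<subseteq> {1..r}" "i\<^sub>0 \<in> J" "j\<^sub>0 \<in> J'"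
  shows "alg_null (coeff_indices d r)
    {u. \<exists>(x :: real ^ 'n::finite) y c L L'. x \<noteq> y \<and> weights r J i\<^sub>0 L \<and> weights r J' j\<^sub>0 L' \<and>
       (d \<ge> 3 \<or> L j\<^sub>0 * L' i\<^sub>0 \<noteq> 1) \<and> (\<forall>i\<in>J. poly_family d u i x = c) \<and>
       (\<forall>i\<in>J'. poly_family d u i y = c) \<and> stationary d r u x L \<and> stationary d r u y L'}"
proof -
  let ?M = "range PX \<union> range PY \<union> PL ` (J - {i\<^sub>0}) \<union> PL' ` (J' - {j\<^sub>0}) \<union> {PC} :: 'n param set"
  let ?R = "Val ` J \<union> Val2 ` J' \<union> range Grad \<union> range Grad2 :: 'n row set"
  let ?x = "\<lambda>t. \<chi> j. t (PX j) :: real ^ 'n" and ?y = "\<lambda>t. \<chi> j. t (PY j) :: real ^ 'n"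
  let ?L = "weight_of (PL :: nat \<Rightarrow> 'n param) J i\<^sub>0" and ?L' = "weight_of (PL' :: nat \<Rightarrow> 'n param) J' j\<^sub>0"
  have fin: "finite J" "finite J'" using assms finite_subset by blast+
  then have pos: "card J > 0" "card J' > 0" using assms by (auto simp: card_gt_0_iff)
  have "card ?M \<le> CARD('n) + CARD('n) + (card J - 1) + (card J' - 1) + 1"
    using card_params[of "J - {i\<^sub>0}" "J' - {j\<^sub>0}" UNIV UNIV] fin assms by simp
  \<comment> \<open>At most 2 n + \<open>card J\<close> + \<open>card J'\<close> - 1 parameters face
    2 n + \<open>card J\<close> + \<open>card J'\<close> rows.\<close>
  also have "\<dots> < card ?R" using pos by (simp add: card_rows_two_points fin)
  finally have card: "card ?M < card ?R" .
  have "alg_null (coeff_indices d r)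
    {u. \<exists>t. independent_rows d r (?x t) (?y t) (?L t) (?L' t) ?R \<and>
      (\<forall>\<rho>\<in>?R. row_value d r u (?x t) (?y t) (?L t) (?L' t) \<rho> = row_rhs r (t PC) (?L t) (?L' t) \<rho>)}"
    using fin card assms
    by (intro alg_null_two_points[where M = ?M] poly_in_weight_of) (auto simp: all_rows_def)
  then show ?thesis
  proof (rule alg_null_subset, intro subsetI, elim CollectE exE conjE)
    fix u and x y :: "real ^ 'n" and c L L'
    assume *: "x \<noteq> y" "weights r J i\<^sub>0 L" "weights r J' j\<^sub>0 L'" "d \<ge> 3 \<or> L j\<^sub>0 * L' i\<^sub>0 \<noteq> 1"
      "\<forall>i\<in>J. poly_family d u i x = c" "\<forall>i\<in>J'. poly_family d u i y = c"
      "stationary d r u x L" "stationary d r u y L'"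
    define t where "t p = (case p of PX j \<Rightarrow> x $ j | PY j \<Rightarrow> y $ j | PL i \<Rightarrow> L i | PL' i \<Rightarrow> L' i | PC \<Rightarrow> c)"
      for p :: "'n param"
    have t: "?x t = x" "?y t = y" "t PC = c" "?L t = L" "?L' t = L'"
      using *(2,3) by (auto simp: t_def weights_def vec_eq_iff intro!: weight_of_eq)
    have "independent_rows d r x y L L' ?R"
      using *(1-4) assms by (intro independent_rows_two_points) (auto simp: weights_def)
    then show "u \<in> {u. \<exists>t. independent_rows d r (?x t) (?y t) (?L t) (?L' t) ?R \<and>
      (\<forall>\<rho>\<in>?R. row_value d r u (?x t) (?y t) (?L t) (?L' t) \<rho> = row_rhs r (t PC) (?L t) (?L' t) \<rho>)}"
      using *(5-8) by (intro CollectI exI[of _ t]) (auto simp: t stationary_def)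
  qed
qed

lemma alg_null_critical_line:
  assumes "d \<ge> 2" "J \<subseteq> {1..r}" "i\<^sub>0 \<in> J"
  shows "alg_null (coeff_indices d r)
    {u. \<exists>(x :: real ^ 'n::finite) y c L. y $ k - x $ k = 1 \<and> weights r J i\<^sub>0 L \<and>
       (\<forall>i\<in>J. poly_family d u i x = c) \<and> stationary d r u x L \<and> stationary d r u y L}"
proof -
  let ?M = "range PX \<union> PY ` (UNIV - {k}) \<union> PL ` (J - {i\<^sub>0}) \<union> PL' ` {} \<union> {PC} :: 'n param set"
  let ?R = "Val ` J \<union> range Grad \<union> range Grad2 :: 'n row set"
  let ?x = "\<lambda>t. \<chi> j. t (PX j) :: real ^ 'n"
  \<comment> \<open>The direction from \<open>x\<close> to \<open>y\<close> has \<open>k\<close>-th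
    entry 1, so \<open>PY k\<close> is no parameter; this compensates for the omitted
    \<open>Val2\<close> rows.\<close>
  let ?y = "\<lambda>t. \<chi> j. t (PX j) + (if j = k then 1 else t (PY j)) :: real ^ 'n"
  let ?L = "weight_of (PL :: nat \<Rightarrow> 'n param) J i\<^sub>0"
  have fin: "finite J" using assms finite_subset by blast
  then have pos: "card J > 0" using assms by (auto simp: card_gt_0_iff)
  have "card ?M \<le> CARD('n) + (CARD('n) - 1) + (card J - 1) + 1"
    using card_params[of "J - {i\<^sub>0}" "{}" UNIV "UNIV - {k}"] fin assms by simp
  also have "\<dots> < card ?R" unfolding card_rows_line[OF fin]
    using pos zero_less_card_finite[where 'a = 'n] by linarith
  finally have card: "card ?M < card ?R" .
  have y: "poly_in ?M (\<lambda>t. ?y t $ j)" for j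
    by (cases "j = k") (simp_all add: poly_in_add poly_in_const poly_in_var)
  have "alg_null (coeff_indices d r)
    {u. \<exists>t. independent_rows d r (?x t) (?y t) (?L t) (?L t) ?R \<and>
      (\<forall>\<rho>\<in>?R. row_value d r u (?x t) (?y t) (?L t) (?L t) \<rho> = row_rhs r (t PC) (?L t) (?L t) \<rho>)}"
    using fin card assms y
    by (intro alg_null_two_points[where M = ?M] poly_in_weight_of) (auto simp: all_rows_def)
  then show ?thesis
  proof (rule alg_null_subset, intro subsetI, elim CollectE exE conjE)
    fix u and x y :: "real ^ 'n" and c L
    assume *: "y $ k - x $ k = 1" "weights r J i\<^sub>0 L" "\<forall>i\<in>J. poly_family d u i x = c"
      "stationary d r u x L" "stationary d r u y L"
    define t where "t p = (case p of PX j \<Rightarrow> x $ j | PY j \<Rightarrow> y $ j - x $ j | PL i \<Rightarrow> L i | PL' i \<Rightarrow> 0 | PC \<Rightarrow> c)"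
      for p :: "'n param"
    have t: "?x t = x" "?y t = y" "t PC = c" "?L t = L"
      using *(1,2) by (auto simp: t_def weights_def vec_eq_iff intro!: weight_of_eq)
    have "independent_rows d r x y L L ?R"
      using *(1,2) assms by (intro independent_rows_line[where k = k]) (auto simp: weights_def)
    then show "u \<in> {u. \<exists>t. independent_rows d r (?x t) (?y t) (?L t) (?L t) ?R \<and>
      (\<forall>\<rho>\<in>?R. row_value d r u (?x t) (?y t) (?L t) (?L t) \<rho> = row_rhs r (t PC) (?L t) (?L t) \<rho>)}"
      using *(3-5) by (intro CollectI exI[of _ t]) (auto simp: t stationary_def)
  qed
qed

text \<open>The bounds on the supports are decisive: the free weights and \<open>c\<close> are at
  most 2 n + 1 parameters against 2 n + 2 rows.\<close>

lemma alg_null_affine_distinct_weights: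
  assumes "d \<ge> 1" "J \<subseteq> {1..r}" "J' \<subseteq> {1..r}" "i\<^sub>0 \<in> J" "j\<^sub>0 \<in> J'"
    and "card J \<le> CARD('n) + 1" "card J' \<le> CARD('n) + 1"
  shows "alg_null (coeff_indices d r)
    {u. \<exists>c L L'. weights r J i\<^sub>0 L \<and> weights r J' j\<^sub>0 L' \<and> L j\<^sub>0 * L' i\<^sub>0 \<noteq> 1 \<and>
       (\<Sum>i\<in>{1..r}. L i * poly_family d u i (0 :: real ^ 'n::finite)) = c * (\<Sum>i\<in>{1..r}. L i) \<and>
       (\<Sum>i\<in>{1..r}. L' i * poly_family d u i (0 :: real ^ 'n)) = c * (\<Sum>i\<in>{1..r}. L' i) \<and>
       stationary d r u (0 :: real ^ 'n) L \<and> stationary d r u 0 L'}"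
proof -
  let ?M = "PX ` {} \<union> PY ` {} \<union> PL ` (J - {i\<^sub>0}) \<union> PL' ` (J' - {j\<^sub>0}) \<union> {PC} :: 'n param set"
  let ?R = "{Wval, Wval2} \<union> range Grad \<union> range Grad2 :: 'n row set"
  let ?L = "weight_of (PL :: nat \<Rightarrow> 'n param) J i\<^sub>0" and ?L' = "weight_of (PL' :: nat \<Rightarrow> 'n param) J' j\<^sub>0"
  have fin: "finite J" "finite J'" using assms finite_subset by blast+
  have "card ?M \<le> (card J - 1) + (card J' - 1) + 1"
    using card_params[of "J - {i\<^sub>0}" "J' - {j\<^sub>0}" "{}" "{} :: 'n set"] fin assms by simp
  also have "\<dots> < card ?R" unfolding card_rows_affine using assms(6,7) by linarith
  finally have card: "card ?M < card ?R" .
  have "alg_null (coeff_indices d r)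
    {u. \<exists>t. independent_rows d r 0 0 (?L t) (?L' t) ?R \<and>
      (\<forall>\<rho>\<in>?R. row_value d r u 0 0 (?L t) (?L' t) \<rho> = row_rhs r (t PC) (?L t) (?L' t) \<rho>)}"
    using fin card assms
    by (intro alg_null_two_points[where M = ?M and x = "\<lambda>_. 0" and y = "\<lambda>_. 0"] poly_in_weight_of) (auto simp: all_rows_def)
  then show ?thesis
  proof (rule alg_null_subset, intro subsetI, elim CollectE exE conjE)
    fix u :: "nat \<times> ('n \<Rightarrow> nat) \<Rightarrow> real" and c L L'
    assume *: "weights r J i\<^sub>0 L" "weights r J' j\<^sub>0 L'" "L j\<^sub>0 * L' i\<^sub>0 \<noteq> 1"
       "(\<Sum>i\<in>{1..r}. L i * poly_family d u i (0 :: real ^ 'n)) = c * (\<Sum>i\<in>{1..r}. L i)"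
       "(\<Sum>i\<in>{1..r}. L' i * poly_family d u i (0 :: real ^ 'n)) = c * (\<Sum>i\<in>{1..r}. L' i)"
       "stationary d r u (0 :: real ^ 'n) L" "stationary d r u 0 L'"
    define t where "t p = (case p of PX j \<Rightarrow> 0 | PY j \<Rightarrow> 0 | PL i \<Rightarrow> L i | PL' i \<Rightarrow> L' i | PC \<Rightarrow> c)"
      for p :: "'n param"
    have t: "t PC = c" "?L t = L" "?L' t = L'"
      using *(1,2) by (auto simp: t_def weights_def intro!: weight_of_eq)
    have "independent_rows d r 0 0 L L' ?R"
      using *(1-3) assms
      by (intro independent_rows_affine_distinct_weights) (auto simp: weights_def)
    then show "u \<in> {u. \<exists>t. independent_rows d r 0 0 (?L t) (?L' t) ?R \<and>
      (\<forall>\<rho>\<in>?R. row_value d r u 0 0 (?L t) (?L' t) \<rho> = row_rhs r (t PC) (?L t) (?L' t) \<rho>)}"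
      using *(4-7) by (intro CollectI exI[of _ t]) (auto simp: t stationary_def)
  qed
qed

text \<open>The n - 1 free entries of \<open>w\<close> and the \<open>card J - 1\<close> free
  weights face n + \<open>card J\<close> - 1 rows; prescribing only differences of values removes
  the common value from the parameters.\<close>

lemma alg_null_affine_same_weights:
  assumes "d \<ge> 1" "J \<subseteq> {1..r}" "i\<^sub>0 \<in> J"
  shows "alg_null (coeff_indices d r)
    {u. \<exists>(w :: real ^ 'n::finite) L. w $ k = 1 \<and> weights r J i\<^sub>0 L \<and>
       (\<forall>i\<in>J. poly_family d u i w = poly_family d u i 0) \<and> stationary d r u (0 :: real ^ 'n) L}"
proof -
  let ?M = "PX ` {} \<union> PY ` (UNIV - {k}) \<union> PL ` (J - {i\<^sub>0}) :: 'n param set"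
  let ?R = "Dif ` (J - {i\<^sub>0}) \<union> range Grad :: 'n row set"
  let ?w = "\<lambda>t. \<chi> j. (if j = k then 1 else t (PY j)) :: real ^ 'n"
  let ?L = "weight_of (PL :: nat \<Rightarrow> 'n param) J i\<^sub>0"
  have fin: "finite J" using assms finite_subset by blast
  have "card ?M \<le> card (PY ` (UNIV - {k}) :: 'n param set) + card (PL ` (J - {i\<^sub>0}) :: 'n param set)"
    using card_Un_le[of "PY ` (UNIV - {k})" "PL ` (J - {i\<^sub>0})"] by simp
  also have "\<dots> \<le> (CARD('n) - 1) + (card J - 1)"
    using fin assms card_image_le[of "UNIV - {k}" PY] card_image_le[of "J - {i\<^sub>0}" "PL :: _ \<Rightarrow> 'n param"]
    by (intro add_mono) auto
  also have "\<dots> < card ?R"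
    unfolding card_rows_affine_same[OF finite_Diff[OF fin]] card_Diff_singleton[OF assms(3)]
    using zero_less_card_finite[where 'a = 'n] by linarith
  finally have card: "card ?M < card ?R" .
  have w: "poly_in ?M (\<lambda>t. ?w t $ j)" for j
    by (cases "j = k") (simp_all add: poly_in_add poly_in_const poly_in_var)
  have "alg_null (coeff_indices d r)
    {u. \<exists>t. independent_rows d r 0 (?w t) (?L t) (\<lambda>_. 0) ?R \<and>
      (\<forall>\<rho>\<in>?R. row_value d r u 0 (?w t) (?L t) (\<lambda>_. 0) \<rho> = row_rhs r 0 (?L t) (\<lambda>_. 0) \<rho>)}"
    using fin card assms w
    by (intro alg_null_two_points[where M = ?M and x = "\<lambda>_. 0" and L' = "\<lambda>_ _. 0" and c = "\<lambda>_. 0"] poly_in_weight_of) (auto simp: all_rows_def)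
  then show ?thesis
  proof (rule alg_null_subset, intro subsetI, elim CollectE exE conjE)
    fix u and w :: "real ^ 'n" and L
    assume *: "w $ k = 1" "weights r J i\<^sub>0 L" "\<forall>i\<in>J. poly_family d u i w = poly_family d u i 0"
      "stationary d r u 0 L"
    define t where "t p = (case p of PX j \<Rightarrow> 0 | PY j \<Rightarrow> w $ j | PL i \<Rightarrow> L i | PL' i \<Rightarrow> 0 | PC \<Rightarrow> 0)"
      for p :: "'n param"
    have t: "?w t = w" "?L t = L"
      using *(1,2) by (auto simp: t_def weights_def vec_eq_iff intro!: weight_of_eq)
    have "independent_rows d r 0 w L (\<lambda>_. 0) ?R"
      using *(1,2) assms
      by (intro independent_rows_affine_same_weights[where k = k]) (auto simp: weights_def)
    then show "u \<in> {u. \<exists>t. independent_rows d r 0 (?w t) (?L t) (\<lambda>_. 0) ?R \<and>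
      (\<forall>\<rho>\<in>?R. row_value d r u 0 (?w t) (?L t) (\<lambda>_. 0) \<rho> = row_rhs r 0 (?L t) (\<lambda>_. 0) \<rho>)}"
      using *(3,4) by (intro CollectI exI[of _ t]) (auto simp: t stationary_def)
  qed
qed

section \<open>From critical points to exceptional coefficient tuples\<close>

lemma critical_point_weights:
  fixes f :: "real ^ 'n::finite \<Rightarrow> real"
  assumes f: "f \<in> continuous_selections d r u" and crit: "critical_point f x"
  obtains L where "\<And>i. L i \<ge> 0" "\<And>i. i \<notin> {1..r} \<Longrightarrow> L i = 0" "(\<Sum>i\<in>{1..r}. L i) = 1"
    "card {i. L i \<noteq> 0} \<le> CARD('n) + 1" "\<And>i. L i \<noteq> 0 \<Longrightarrow> poly_family d u i x = f x"
    "stationary d r u x L"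
proof -
  define A where "A = {i \<in> {1..r}. poly_family d u i x = f x}"
  let ?G = "\<lambda>i. poly_gradient d u i x"
  have "0 \<in> convex hull (?G ` A)"
    unfolding A_def
  proof (rule critical_point_of_selection[OF _ _ _ has_derivative_poly_family continuous_on_poly_gradient crit])
    show "continuous_on UNIV f" "\<exists>i\<in>{1..r}. f y = poly_family d u i y" for y
      using f by (auto simp: continuous_selections_def)
  qed simp
  then obtain S where S: "finite S" "S \<subseteq> ?G ` A" "card S \<le> CARD('n) + 1" "0 \<in> convex hull S"
    unfolding caratheodory[of "?G ` A"] by auto
  \<comment> \<open>One index is kept per gradient, so the bound on \<open>S\<close> also bounds the
    support when several active polynomials share a gradient.\<close>
  then obtain K where K: "K \<subseteq> A" "inj_on ?G K" "S = ?G ` K"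
    unfolding subset_image_inj by blast
  obtain w where w: "\<forall>z\<in>S. 0 \<le> w z" "sum w S = 1" "(\<Sum>z\<in>S. w z *\<^sub>R z) = 0"
    using S(4) unfolding convex_hull_finite[OF S(1)] by auto
  define L where "L i = (if i \<in> K then w (?G i) else 0)" for i
  have K1: "K \<subseteq> {1..r}" "finite K" using K(1) by (auto simp: A_def intro: finite_subset)
  have sumL: "(\<Sum>i\<in>{1..r}. g (L i) i) = (\<Sum>i\<in>K. g (w (?G i)) i)"
    if "\<And>i. g 0 i = 0" for g :: "real \<Rightarrow> nat \<Rightarrow> real"
    using K1 that by (intro sum.mono_neutral_cong_right) (auto simp: L_def)
  show ?thesis
  proof (rule that)
    show "L i \<ge> 0" for i using w(1) K(3) by (simp add: L_def)
    show "L i = 0" if "i \<notin> {1..r}" for i using K1 that by (auto simp: L_def)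
    show "(\<Sum>i\<in>{1..r}. L i) = 1"
      using sumL[of "\<lambda>a i. a"] w(2) unfolding K(3) sum.reindex[OF K(2)] by simp
    have "card {i. L i \<noteq> 0} \<le> card K"
      by (intro card_mono K1) (auto simp: L_def)
    also have "\<dots> = card S" unfolding K(3) by (rule card_image[OF K(2), symmetric])
    finally show "card {i. L i \<noteq> 0} \<le> CARD('n) + 1" using S(3) by simp
    show "poly_family d u i x = f x" if "L i \<noteq> 0" for i
      using that K(1) by (auto simp: L_def A_def split: if_splits)
    show "stationary d r u x L"
      unfolding stationary_def
    proof
      fix l
      have "(\<Sum>i\<in>{1..r}. L i * ?G i $ l) = (\<Sum>i\<in>K. w (?G i) * ?G i $ l)"
        using sumL[of "\<lambda>a i. a * ?G i $ l"] by simp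
      also have "\<dots> = (\<Sum>z\<in>S. w z *\<^sub>R z) $ l"
        unfolding K(3) sum.reindex[OF K(2)] by simp
      finally show "(\<Sum>i\<in>{1..r}. L i * ?G i $ l) = 0" using w(3) by simp
    qed
  qed
qed

lemma stationary_divide:
  assumes "stationary d r u x L"
  shows "stationary d r u x (\<lambda>i. L i / a)"
  using assms unfolding stationary_def by (simp flip: sum_divide_distrib)

lemma stationary_along_line:
  assumes "stationary 2 r u x L" "stationary 2 r u y L"
  shows "stationary 2 r u (x + s *\<^sub>R (y - x)) L"
  unfolding stationary_def
proof
  fix l
  have "(\<Sum>i\<in>{1..r}. L i * poly_gradient 2 u i (x + s *\<^sub>R (y - x)) $ l) =
      (1 - s) * (\<Sum>i\<in>{1..r}. L i * poly_gradient 2 u i x $ l) +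
      s * (\<Sum>i\<in>{1..r}. L i * poly_gradient 2 u i y $ l)"
    unfolding poly_gradient_degree_2 sum_distrib_left sum.distrib[symmetric]
    by (intro sum.cong) (simp_all add: algebra_simps)
  then show "(\<Sum>i\<in>{1..r}. L i * poly_gradient 2 u i (x + s *\<^sub>R (y - x)) $ l) = 0"
    using assms unfolding stationary_def by simp
qed

text \<open>The weighted sum is affine with zero gradient, hence constant, and its value can be read
  off at the origin.\<close>

lemma affine_weighted_value:
  assumes "stationary 1 r u x L" "\<And>i. L i \<noteq> 0 \<Longrightarrow> poly_family 1 u i x = c"
  shows "stationary 1 r u 0 L"
    "(\<Sum>i\<in>{1..r}. L i * poly_family 1 u i (0 :: real ^ 'n::finite)) = c * (\<Sum>i\<in>{1..r}. L i)"
proof -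
  show stat: "stationary 1 r u 0 L"
    using assms(1) unfolding stationary_def poly_gradient_degree_1[of u _ x] .
  have "(\<Sum>i\<in>{1..r}. L i * (x \<bullet> poly_gradient 1 u i 0)) =
      (\<Sum>l\<in>UNIV. x $ l * (\<Sum>i\<in>{1..r}. L i * poly_gradient 1 u i 0 $ l))"
    unfolding inner_vec_def sum_distrib_left
    by (subst sum.swap) (simp add: mult_ac)
  also have "\<dots> = 0" using stat unfolding stationary_def by simp
  finally have "(\<Sum>i\<in>{1..r}. L i * poly_family 1 u i 0) =
      (\<Sum>i\<in>{1..r}. L i * poly_family 1 u i 0) + (\<Sum>i\<in>{1..r}. L i * (x \<bullet> poly_gradient 1 u i 0))"
    by simp
  also have "\<dots> = (\<Sum>i\<in>{1..r}. L i * poly_family 1 u i x)"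
    unfolding sum.distrib[symmetric] poly_family_degree_1[of u _ x] by (simp add: distrib_left)
  also have "\<dots> = (\<Sum>i\<in>{1..r}. L i * c)"
    using assms(2) by (intro sum.cong) auto
  finally show "(\<Sum>i\<in>{1..r}. L i * poly_family 1 u i 0) = c * (\<Sum>i\<in>{1..r}. L i)"
    by (simp add: sum_distrib_left mult.commute)
qed

text \<open>Distinct weight vectors of equal total are not comparable. Applied in both directions,
  this supplies the two normalisation indices.\<close>

lemma ex_greater_of_equal_sums:
  fixes L L' :: "'a \<Rightarrow> real"
  assumes "finite A" "sum L A = sum L' A" "\<And>i. i \<notin> A \<Longrightarrow> L i = L' i" "L \<noteq> L'"
  shows "\<exists>i. L i > L' i"
proof (rule ccontr)
  assume "\<not> ?thesis"
  then have le: "\<And>i. L i \<le> L' i" by (simp add: not_less)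
  obtain i where "L i \<noteq> L' i" using assms(4) by auto
  then have "i \<in> A" "L i < L' i" using assms(3) le[of i] by auto
  then have "sum L A < sum L' A"
    using assms(1) le by (intro sum_strict_mono_ex1) auto
  then show False using assms(2) by simp
qed

lemma alg_null_exceptional:
  assumes "d \<ge> 1"
  shows "alg_null (coeff_indices d r) {u. \<exists>(x :: real ^ 'n::finite) x' f f'.
    f \<in> continuous_selections d r u \<and> f' \<in> continuous_selections d r u \<and>
    x \<noteq> x' \<and> critical_point f x \<and> critical_point f' x' \<and> f x = f' x'}"
proof -
  define Z\<^sub>1 where "Z\<^sub>1 J J' i j = {u. \<exists>(x :: real ^ 'n) y c L L'. x \<noteq> y \<and> weights r J i L \<and> weights r J' j L' \<and>
       (d \<ge> 3 \<or> L j * L' i \<noteq> 1) \<and> (\<forall>i\<in>J. poly_family d u i x = c) \<and>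
       (\<forall>i\<in>J'. poly_family d u i y = c) \<and> stationary d r u x L \<and> stationary d r u y L'}" for J J' i j
  define Z\<^sub>2 where "Z\<^sub>2 J i k = {u. \<exists>(x :: real ^ 'n) y c L. y $ k - x $ k = 1 \<and> weights r J i L \<and>
       (\<forall>i\<in>J. poly_family d u i x = c) \<and> stationary d r u x L \<and> stationary d r u y L}" for J i k
  define Z\<^sub>3 where "Z\<^sub>3 J J' i j = {u. \<exists>c L L'. weights r J i L \<and> weights r J' j L' \<and> L j * L' i \<noteq> 1 \<and>
       (\<Sum>i\<in>{1..r}. L i * poly_family d u i (0 :: real ^ 'n)) = c * (\<Sum>i\<in>{1..r}. L i) \<and>
       (\<Sum>i\<in>{1..r}. L' i * poly_family d u i (0 :: real ^ 'n)) = c * (\<Sum>i\<in>{1..r}. L' i) \<and>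
       stationary d r u (0 :: real ^ 'n) L \<and> stationary d r u 0 L'}" for J J' i j
  define Z\<^sub>4 where "Z\<^sub>4 J i k = {u. \<exists>(w :: real ^ 'n) L. w $ k = 1 \<and> weights r J i L \<and>
       (\<forall>i\<in>J. poly_family d u i w = poly_family d u i 0) \<and> stationary d r u (0 :: real ^ 'n) L}" for J i k
  \<comment> \<open>Supports, normalisation indices and the coordinate separating the points depend
    on the critical points, but only finitely many choices exist.\<close>
  define X where "X = {(J, J', i, j, k :: 'n). J \<subseteq> {1..r} \<and> J' \<subseteq> {1..r} \<and> i \<in> J \<and> j \<in> J' \<and>
      card J \<le> CARD('n) + 1 \<and> card J' \<le> CARD('n) + 1}"
  define Z where "Z = (\<lambda>(J, J', i, j, k). if d \<ge> 2 then Z\<^sub>1 J J' i j \<union> Z\<^sub>2 J i k else Z\<^sub>3 J J' i j \<union> Z\<^sub>4 J i k)"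
  have "X \<subseteq> Pow {1..r} \<times> Pow {1..r} \<times> {1..r} \<times> {1..r} \<times> UNIV" by (auto simp: X_def)
  then have "finite X" by (rule finite_subset) simp
  moreover have "alg_null (coeff_indices d r) (Z p)" if p: "p \<in> X" for p
  proof -
    obtain J J' i j k where p_eq: "p = (J, J', i, j, k)" by (metis prod_cases5)
    have J: "J \<subseteq> {1..r}" "J' \<subseteq> {1..r}" "i \<in> J" "j \<in> J'" "card J \<le> CARD('n) + 1" "card J' \<le> CARD('n) + 1"
      using p unfolding X_def p_eq by auto
    show ?thesis
    proof (cases "d \<ge> 2")
      case True
      have "alg_null (coeff_indices d r) (Z\<^sub>1 J J' i j)"
        unfolding Z\<^sub>1_def using True J(1-4) by (rule alg_null_two_critical_points)
      moreover have "alg_null (coeff_indices d r) (Z\<^sub>2 J i k)"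
        unfolding Z\<^sub>2_def using True J(1,3) by (rule alg_null_critical_line)
      ultimately show ?thesis using True by (simp add: Z_def p_eq alg_null_Un)
    next
      case False
      have "alg_null (coeff_indices d r) (Z\<^sub>3 J J' i j)"
        unfolding Z\<^sub>3_def using assms J by (rule alg_null_affine_distinct_weights)
      moreover have "alg_null (coeff_indices d r) (Z\<^sub>4 J i k)"
        unfolding Z\<^sub>4_def using assms J(1,3) by (rule alg_null_affine_same_weights)
      ultimately show ?thesis using False by (simp add: Z_def p_eq alg_null_Un)
    qed
  qed
  ultimately have "alg_null (coeff_indices d r) (\<Union>p\<in>X. Z p)" by (rule alg_null_UN)
  then show ?thesis
  proof (rule alg_null_subset, intro subsetI, elim CollectE exE conjE)
    fix u and x y :: "real ^ 'n" and f f'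
    assume f: "f \<in> continuous_selections d r u" "critical_point f x"
      and f': "f' \<in> continuous_selections d r u" "critical_point f' y"
      and xy: "x \<noteq> y" "f x = f' y"
    obtain L where L: "\<And>i. L i \<ge> 0" "\<And>i. i \<notin> {1..r} \<Longrightarrow> L i = 0" "(\<Sum>i\<in>{1..r}. L i) = 1"
      "card {i. L i \<noteq> 0} \<le> CARD('n) + 1" "\<And>i. L i \<noteq> 0 \<Longrightarrow> poly_family d u i x = f x"
      "stationary d r u x L"
      using f by (rule critical_point_weights) blast
    obtain L' where L': "\<And>i. L' i \<ge> 0" "\<And>i. i \<notin> {1..r} \<Longrightarrow> L' i = 0" "(\<Sum>i\<in>{1..r}. L' i) = 1"
      "card {i. L' i \<noteq> 0} \<le> CARD('n) + 1" "\<And>i. L' i \<noteq> 0 \<Longrightarrow> poly_family d u i y = f x"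
      "stationary d r u y L'"
      using f' unfolding xy(2) by (rule critical_point_weights) blast
    define J where "J = {i. L i \<noteq> 0}"
    define J' where "J' = {i. L' i \<noteq> 0}"
    have J: "J \<subseteq> {1..r}" "J' \<subseteq> {1..r}" using L(2) L'(2) unfolding J_def J'_def by blast+
    obtain k where k: "y $ k \<noteq> x $ k" using xy(1) by (metis vec_eq_iff)
    \<comment> \<open>With \<open>L i > L' i\<close> and \<open>L' j > L j\<close>, the product
      \<open>L j * L' i\<close> is less than \<open>L i * L' j\<close>; after normalisation this
      becomes \<open>N j * N' i \<noteq> 1\<close>.\<close>
    obtain i j where ij: "L i \<noteq> 0" "L' j \<noteq> 0" "L \<noteq> L' \<longrightarrow> L j * L' i \<noteq> L i * L' j"
    proof (cases "L = L'")
      case True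
      moreover obtain i where "L i \<noteq> 0" using L(3) by (metis sum.neutral zero_neq_one)
      ultimately show ?thesis using that by blast
    next
      case False
      obtain i where i: "L i > L' i"
        using ex_greater_of_equal_sums[of "{1..r}" L L'] L(2,3) L'(2,3) False by auto
      obtain j where j: "L' j > L j"
        using ex_greater_of_equal_sums[of "{1..r}" L' L] L(2,3) L'(2,3) False by auto
      have pos: "L i > 0" "L' j > 0" using i j L(1)[of j] L'(1)[of i] by linarith+
      have "L j * L' i \<le> L j * L i" using i L(1) by (intro mult_left_mono) auto
      also have "\<dots> < L' j * L i" using j pos by (intro mult_strict_right_mono) auto
      finally show ?thesis using that[of i j] pos by (simp add: mult.commute)
    qed
    define N where "N a = L a / L i" for a
    define N' where "N' a = L' a / L' j" for a
    have N: "weights r J i N" "weights r J' j N'"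
      using ij J by (auto simp: weights_def N_def N'_def J_def J'_def)
    have NN: "N j * N' i \<noteq> 1" if "L \<noteq> L'"
      using ij that by (simp add: N_def N'_def divide_eq_eq mult_ac)
    have stat: "stationary d r u x N" "stationary d r u y N'"
      unfolding N_def N'_def by (intro stationary_divide L L')+
    have val: "poly_family d u a x = f x" if "N a \<noteq> 0" for a
      using that L(5) by (auto simp: N_def)
    have val': "poly_family d u a y = f x" if "N' a \<noteq> 0" for a
      using that L'(5) by (auto simp: N'_def)
    have valJ: "\<forall>a\<in>J. poly_family d u a x = f x" "\<forall>a\<in>J'. poly_family d u a y = f x"
      using L(5) L'(5) by (auto simp: J_def J'_def)
    define s where "s = 1 / (y $ k - x $ k)"
    have "(J, J', i, j, k) \<in> X"
      using J ij L(4) L'(4) by (simp add: X_def J_def J'_def)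
    moreover have "u \<in> Z (J, J', i, j, k)"
    proof (cases "d \<ge> 2")
      case True
      have "u \<in> Z\<^sub>1 J J' i j \<union> Z\<^sub>2 J i k"
      proof (cases "d \<ge> 3 \<or> L \<noteq> L'")
        case True
        then have "d \<ge> 3 \<or> N j * N' i \<noteq> 1" using NN by blast
        then have "u \<in> Z\<^sub>1 J J' i j"
          unfolding Z\<^sub>1_def using xy(1) N stat valJ by blast
        then show ?thesis ..
      next
        case False
        then have d: "d = 2" and LL: "L = L'" using True by auto
        have "stationary d r u y N"
          unfolding N_def LL by (intro stationary_divide L')
        \<comment> \<open>\<open>Z\<^sub>2\<close> prescribes no value at its second point, so
          \<open>y\<close> may be replaced by the point of the critical line with the normalised
          \<open>k\<close>-th coordinate.\<close>
        then have "stationary d r u (x + s *\<^sub>R (y - x)) N"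
          using stat(1) unfolding d by (intro stationary_along_line)
        moreover have "(x + s *\<^sub>R (y - x)) $ k - x $ k = 1" using k by (simp add: s_def)
        ultimately have "u \<in> Z\<^sub>2 J i k"
          unfolding Z\<^sub>2_def using N stat valJ by blast
        then show ?thesis ..
      qed
      then show ?thesis using True by (simp add: Z_def)
    next
      case False
      then have d: "d = 1" using assms by simp
      have "u \<in> Z\<^sub>3 J J' i j \<union> Z\<^sub>4 J i k"
      proof (cases "L = L'")
        case False
        have "u \<in> Z\<^sub>3 J J' i j"
          unfolding Z\<^sub>3_def d
          using N NN[OF False] affine_weighted_value[of r u x N "f x"]
            affine_weighted_value[of r u y N' "f x"] stat val val' unfolding d by blast
        then show ?thesis ..
      next
        case LL: True
        have "poly_family d u a (s *\<^sub>R (y - x)) = poly_family d u a 0" if "a \<in> J" for a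
        proof -
          have "a \<in> J'" using that LL by (simp add: J_def J'_def)
          then have "poly_family 1 u a x = poly_family 1 u a y" using valJ that d by simp
          \<comment> \<open>An affine polynomial with equal values at both points has slope zero
            along \<open>y - x\<close>, hence along its multiple
            \<open>s *\<^sub>R (y - x)\<close>.\<close>
          then have "(y - x) \<bullet> poly_gradient 1 u a 0 = 0"
            using poly_family_degree_1[of u a x] poly_family_degree_1[of u a y]
            unfolding inner_diff_left by linarith
          then show ?thesis
            unfolding d poly_family_degree_1[of u a "s *\<^sub>R (y - x)"] by simp
        qed
        moreover have "(s *\<^sub>R (y - x)) $ k = 1" using k by (simp add: s_def)
        moreover have "stationary d r u 0 N"
          using affine_weighted_value(1)[of r u x N "f x"] stat(1) val unfolding d by blast
        ultimately have "u \<in> Z\<^sub>4 J i k" unfolding Z\<^sub>4_def using N by blast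
        then show ?thesis ..
      qed
      then show ?thesis using False by (simp add: Z_def)
    qed
    ultimately show "u \<in> (\<Union>p\<in>X. Z p)" by blast
  qed
qed

theorem corollary4p2:
  fixes d r :: nat
  assumes "d \<ge> 1" and "r \<ge> 1"
  shows "\<exists>U :: (nat \<times> ('n::finite \<Rightarrow> nat) \<Rightarrow> real) set.
    openin (coeff_space d r) U \<and>
    coeff_space d r closure_of U = topspace (coeff_space d r) \<and>
    semialgebraic (coeff_indices d r) U \<and>
    (\<forall>u\<in>U.
      (\<forall>(x :: real ^ 'n) x'. \<forall>f\<in>continuous_selections d r u. \<forall>f'\<in>continuous_selections d r u.
         x \<noteq> x' \<longrightarrow> critical_point f x \<longrightarrow> critical_point f' x' \<longrightarrow> f x \<noteq> f' x') \<and>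
      (\<forall>f\<in>continuous_selections d r u. \<exists>\<^sub>\<le>\<^sub>1 x :: real ^ 'n. optimal_solution f x))"
proof -
  let ?B = "{u. \<exists>(x :: real ^ 'n) x' f f'.
    f \<in> continuous_selections d r u \<and> f' \<in> continuous_selections d r u \<and>
    x \<noteq> x' \<and> critical_point f x \<and> critical_point f' x' \<and> f x = f' x'}"
  have "\<exists>U. openin (coeff_space d r) U \<and>
      coeff_space d r closure_of U = topspace (coeff_space d r) \<and>
      semialgebraic (coeff_indices d r) U \<and> U \<inter> ?B = {}"
    unfolding coeff_space_def
    by (intro alg_null_avoided_by_open_dense_semialgebraic finite_coeff_indices
        alg_null_exceptional assms(1))
  then obtain U where U: "openin (coeff_space d r) U"
    "coeff_space d r closure_of U = topspace (coeff_space d r)"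
    "semialgebraic (coeff_indices d r) U" "U \<inter> ?B = {}"
    by (elim exE conjE)
  have crit: "f x \<noteq> f' x'"
    if "u \<in> U" "f \<in> continuous_selections d r u" "f' \<in> continuous_selections d r u"
      "x \<noteq> x'" "critical_point f x" "critical_point f' x'" for u f f' and x x' :: "real ^ 'n"
    using that U(4) by blast
  have "x = x'" if "u \<in> U" "f \<in> continuous_selections d r u" "optimal_solution f x" "optimal_solution f x'"
    for u f and x x' :: "real ^ 'n"
  proof (rule ccontr)
    assume "x \<noteq> x'"
    then have "f x \<noteq> f x'"
      using that by (intro crit[of u f f x x'] optimal_solution_imp_critical_point)
    moreover have "f x = f x'"
      using that(3,4) unfolding optimal_solution_def by (intro antisym) auto
    ultimately show False by simp
  qed
  then have "\<exists>\<^sub>\<le>\<^sub>1 x :: real ^ 'n. optimal_solution f x" if "u \<in> U" "f \<in> continuous_selections d r u" for u f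
    using that unfolding Uniq_def by blast
  with crit show ?thesis
    by (intro exI[of _ U] conjI ballI allI impI U(1-3))
qed

end
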